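(* Let $n\ge 1$, $p\ge 2$, $S\ge 1$ be integers with $3S\le p$, let $\sigma>0$, let $t>0$, and let $X\in\mathbf{R}^{n\times p}$ be a fixed matrix whose columns have unit Euclidean norm and which satisfies $\delta_{2S}+\theta_{S,2S}<1-t$. Let $\beta\in\mathbf{R}^p$ be $S$-sparse and let $y=X\beta+z$ with $z\sim N(0,\sigma^2I_n)$. Let $a\ge 0$ and set $\lambda_p:=(\sqrt{1+a}+t^{-1})\sqrt{2\log p}$ (the choice $a=0$ gives $\lambda_p=(1+t^{-1})\sqrt{2\log p}$). Then, with probability exceeding $1-\left(\sqrt{\pi\log p}\cdot p^{a}\right)^{-1}$, the Dantzig selector $\hat\beta$ with parameter $\lambda_p$ (any solution of the minimization problem defining it) obeys $$\|\hat\beta-\beta\|_{\ell_2}^2\le C_2^2\cdot\lambda_p^2\cdot\left(\sigma^2+\sum_{i=1}^p\min(\beta_i^2,\sigma^2)\right),$$ where $C_2$ depends only on $\delta:=\delta_{2S}$ and $\theta:=\theta_{S,2S}$, and may be taken to be $$C_2=2\frac{C_0}{1-\delta-\theta}+2\frac{\theta(1+\delta)}{(1-\delta-\theta)^2}+\frac{1+\delta}{1-\delta-\theta},$$ $$C_0:=2\sqrt2\left(1+\frac{1-\delta^2}{1-\delta-\theta}\right)+\left(1+\frac{1}{\sqrt2}\right)\frac{(1+\delta)^2}{1-\delta-\theta}.$$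
   Context: A vector is $S$-sparse if at most $S$ of its entries are nonzero. For $T\subset\{1,\dots,p\}$, $X_T$ is the $n\times|T|$ submatrix of $X$ formed by the columns indexed by $T$. The $S$-restricted isometry constant $\delta_S$ of $X$ is the smallest number such that $(1-\delta_S)\|c\|_{\ell_2}^2\le\|X_Tc\|_{\ell_2}^2\le(1+\delta_S)\|c\|_{\ell_2}^2$ for all $T$ with $|T|\le S$ and all $c\in\mathbf{R}^T$. For $S+S'\le p$, the restricted orthogonality constant $\theta_{S,S'}$ of $X$ is the smallest number such that $|\langle X_Tc,X_{T'}c'\rangle|\le\theta_{S,S'}\|c\|_{\ell_2}\|c'\|_{\ell_2}$ for all disjoint $T,T'\subseteq\{1,\dots,p\}$ with $|T|\le S$, $|T'|\le S'$ and all coefficient vectors $c\in\mathbf{R}^T$, $c'\in\mathbf{R}^{T'}$. The Dantzig selector with parameter $\lambda_p>0$ is a solution $\hat\beta$ of $$\min_{\tilde\beta\in\mathbf{R}^p}\|\tilde\beta\|_{\ell_1}\quad\text{subject to}\quad\|X^*(y-X\tilde\beta)\|_{\ell_\infty}\le\lambda_p\cdot\sigma,$$ where $X^*$ is the transpose of $X$. *)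

theory Defs
  imports "HOL-Probability.Probability"
begin

definition sparse_vec :: "nat \<Rightarrow> real ^ 'p \<Rightarrow> bool" where
  "sparse_vec S b \<longleftrightarrow> card {i. b $ i \<noteq> 0} \<le> S"

text \<open>
  A coefficient vector indexed by a set \<open>T\<close> of columns is a function on the whole column type of
  which only the values on \<open>T\<close> are used; accordingly its Euclidean norm is \<^term>\<open>L2_set c T\<close>, and
  \<open>sub_mult X T c\<close> is the product of the column submatrix of \<open>X\<close> given by \<open>T\<close> with \<open>c\<close>.
\<close>

definition sub_mult :: "real ^ 'p ^ 'n \<Rightarrow> 'p set \<Rightarrow> ('p \<Rightarrow> real) \<Rightarrow> real ^ 'n" where
  "sub_mult X T c = (\<Sum>j\<in>T. c j *\<^sub>R column j X)"

text \<open>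
  The smallest number exists whenever \<open>S \<ge> 1\<close>; for \<open>S = 0\<close> every real number is admissible.
\<close>

definition ric :: "real ^ 'p ^ 'n \<Rightarrow> nat \<Rightarrow> real" where
  "ric X S = (LEAST d. \<forall>T c. card T \<le> S \<longrightarrow>
     (1 - d) * (L2_set c T)\<^sup>2 \<le> (norm (sub_mult X T c))\<^sup>2 \<and>
     (norm (sub_mult X T c))\<^sup>2 \<le> (1 + d) * (L2_set c T)\<^sup>2)"

text \<open>
  Meant for \<open>S, S' \<ge> 1\<close> with \<open>S + S'\<close> at most the number of columns, where the smallest number
  exists.
\<close>

definition roc :: "real ^ 'p ^ 'n \<Rightarrow> nat \<Rightarrow> nat \<Rightarrow> real" where
  "roc X S S' = (LEAST d. \<forall>T T' c c'. T \<inter> T' = {} \<longrightarrow> card T \<le> S \<longrightarrow> card T' \<le> S' \<longrightarrow>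
     \<bar>sub_mult X T c \<bullet> sub_mult X T' c'\<bar> \<le> d * L2_set c T * L2_set c' T')"

definition l1_norm :: "real ^ 'p \<Rightarrow> real" where
  "l1_norm b = (\<Sum>i\<in>UNIV. \<bar>b $ i\<bar>)"

definition is_dantzig_selector ::
  "real ^ 'p ^ 'n \<Rightarrow> real ^ 'n \<Rightarrow> real \<Rightarrow> real \<Rightarrow> real ^ 'p \<Rightarrow> bool" where
  "is_dantzig_selector X y lam \<sigma> b \<longleftrightarrow>
     is_arg_min l1_norm (\<lambda>b'. infnorm (transpose X *v (y - X *v b')) \<le> lam * \<sigma>) b"

text \<open>
  The law \<open>N(0, \<sigma>\<^sup>2 I)\<close>: the coordinates are independent, each normal with mean \<open>0\<close> and
  standard deviation (not variance) \<open>\<sigma>\<close>.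
\<close>

definition (in prob_space) isotropic_normal :: "('a \<Rightarrow> real ^ 'n) \<Rightarrow> real \<Rightarrow> bool" where
  "isotropic_normal z \<sigma> \<longleftrightarrow>
     indep_vars (\<lambda>_. borel) (\<lambda>i \<omega>. z \<omega> $ i) UNIV \<and>
     (\<forall>i. distributed M lborel (\<lambda>\<omega>. z \<omega> $ i) (normal_density 0 \<sigma>))"

definition C0_const :: "real \<Rightarrow> real \<Rightarrow> real" where
  "C0_const \<delta> \<theta> =
     2 * sqrt 2 * (1 + (1 - \<delta>\<^sup>2) / (1 - \<delta> - \<theta>))
     + (1 + 1 / sqrt 2) * ((1 + \<delta>)\<^sup>2 / (1 - \<delta> - \<theta>))"

definition C2_const :: "real \<Rightarrow> real \<Rightarrow> real" where
  "C2_const \<delta> \<theta> =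
     2 * (C0_const \<delta> \<theta> / (1 - \<delta> - \<theta>))
     + 2 * (\<theta> * (1 + \<delta>) / (1 - \<delta> - \<theta>)\<^sup>2)
     + (1 + \<delta>) / (1 - \<delta> - \<theta>)"

end

theory Submission
  imports Defs "HOL-Real_Asymp.Real_Asymp"
begin

text \<open>
  Put \<open>\<kappa> = sqrt (2 ln p)\<close> and \<open>\<tau> = \<kappa> \<sigma>\<close>. With the required probability every column of \<open>X\<close> has
  inner product at most \<open>sqrt (1 + a) \<tau>\<close> with the noise, by a union bound; on this event the
  estimate is deterministic. Let \<open>m\<close> be about \<open>\<Sum> min (\<beta>\<^sub>i\<^sup>2, \<tau>\<^sup>2) / \<tau>\<^sup>2\<close>, so that at most \<open>m\<close> entries of \<open>\<beta>\<close>
  exceed \<open>\<tau>\<close>, and let \<open>\<beta>2\<close> be the part of \<open>\<beta>\<close> formed by the other entries. Then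
  \<open>\<beta>2 = b' + b''\<close>, where \<open>b'\<close> is small in both the \<open>\<ell>\<^sub>1\<close> and the \<open>\<ell>\<^sub>2\<close> norm and all
  correlations of the columns with \<open>X b''\<close> are at most \<open>\<tau> / t\<close>. Hence \<open>\<beta> - b''\<close> is feasible, and
  comparing the Dantzig selector with it, rather than with \<open>\<beta>\<close>, gives the oracle inequality with
  \<open>m\<close> in place of \<open>S\<close>.
\<close>

section \<open>Block decompositions\<close>

text \<open>Greedy choice: each step adjoins a maximiser of \<open>f\<close> over what is left. The
  clause on \<open>T \<noteq> U\<close> covers sets \<open>U\<close> with fewer than
  \<open>m\<close> elements.\<close>

lemma top_entries:
  fixes f :: "'a \<Rightarrow> real"
  assumes "finite U"
  shows "\<exists>T\<subseteq>U. card T \<le> m \<and> (T \<noteq> U \<longrightarrow> card T = m) \<and> (\<forall>i\<in>T. \<forall>j\<in>U - T. f j \<le> f i)"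
proof (induction m)
  case 0
  then show ?case by (intro exI[of _ "{}"]) auto
next
  case (Suc m)
  then obtain T where T: "T \<subseteq> U" "card T \<le> m" "T \<noteq> U \<longrightarrow> card T = m"
    "\<forall>i\<in>T. \<forall>j\<in>U - T. f j \<le> f i" by blast
  show ?case
  proof (cases "T = U")
    case True
    with T show ?thesis by (intro exI[of _ U]) auto
  next
    case False
    have ne: "finite (U - T)" "U - T \<noteq> {}" using assms False T by auto
    then have "Max (f ` (U - T)) \<in> f ` (U - T)" by simp
    then obtain j where "j \<in> U - T" "f j = Max (f ` (U - T))" by auto
    then have j: "j \<in> U - T" "\<And>k. k \<in> U - T \<Longrightarrow> f k \<le> f j" using ne by simp_all
    have "finite T" using T assms finite_subset by blast
    then show ?thesis using T j False by (intro exI[of _ "insert j T"]) auto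
  qed
qed

lemma L2_set_le_max:
  fixes f :: "'a \<Rightarrow> real"
  assumes "card A \<le> m" "\<And>i. i \<in> A \<Longrightarrow> \<bar>f i\<bar> \<le> \<mu>" "0 \<le> \<mu>"
  shows "L2_set f A \<le> sqrt m * \<mu>"
proof -
  have "(\<Sum>i\<in>A. (f i)\<^sup>2) \<le> (\<Sum>i\<in>A. \<mu>\<^sup>2)"
    using assms by (intro sum_mono) (simp add: abs_le_square_iff[symmetric])
  also have "\<dots> \<le> real m * \<mu>\<^sup>2" using assms by (simp add: mult_right_mono)
  finally have "L2_set f A \<le> sqrt (real m * \<mu>\<^sup>2)" unfolding L2_set_def by simp
  then show ?thesis using assms by (simp add: real_sqrt_mult)
qed

lemma sum_abs_le_L2_set:
  fixes f :: "'a \<Rightarrow> real"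
  assumes "card A \<le> m"
  shows "(\<Sum>i\<in>A. \<bar>f i\<bar>) \<le> sqrt m * L2_set f A"
proof -
  have "(\<Sum>i\<in>A. \<bar>f i\<bar>) = (\<Sum>i\<in>A. \<bar>1\<bar> * \<bar>f i\<bar>)" by simp
  also have "\<dots> \<le> L2_set (\<lambda>_. 1) A * L2_set f A" by (rule L2_set_mult_ineq)
  also have "\<dots> \<le> sqrt m * L2_set f A"
    using assms by (intro mult_right_mono) (auto simp: L2_set_def sum_nonneg)
  finally show ?thesis .
qed

text \<open>
  Split off the \<open>m\<close> largest entries repeatedly; the entries of each block are bounded by the
  average of the preceding one.
\<close>

lemma block_bound:
  fixes f :: "'a \<Rightarrow> real" and \<Phi> :: "'a set \<Rightarrow> real"
  assumes "finite U" and m: "m \<ge> 1" and "K \<ge> 0"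
    and small: "\<And>A. A \<subseteq> U \<Longrightarrow> card A \<le> m \<Longrightarrow> \<Phi> A \<le> K * L2_set f A"
    and sub: "\<And>A B. A \<inter> B = {} \<Longrightarrow> \<Phi> (A \<union> B) \<le> \<Phi> A + \<Phi> B"
    and "\<And>i. i \<in> U \<Longrightarrow> \<bar>f i\<bar> \<le> \<mu>" "0 \<le> \<mu>"
  shows "\<Phi> U \<le> K * (sqrt m * \<mu> + (\<Sum>i\<in>U. \<bar>f i\<bar>) / sqrt m)"
  using assms(1,4,6,7)
proof (induction "card U" arbitrary: U \<mu> rule: less_induct)
  case less
  obtain T where T: "T \<subseteq> U" "card T \<le> m" "T \<noteq> U \<longrightarrow> card T = m"
    "\<forall>i\<in>T. \<forall>j\<in>U - T. \<bar>f j\<bar> \<le> \<bar>f i\<bar>" using top_entries[OF less.prems(1), of m "\<lambda>i. \<bar>f i\<bar>"] by blast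
  have "L2_set f T \<le> sqrt m * \<mu>" using T less.prems by (intro L2_set_le_max) auto
  then have 1: "\<Phi> T \<le> K * (sqrt m * \<mu>)"
    using less.prems(2)[of T] T mult_left_mono[OF _ \<open>K \<ge> 0\<close>] by fastforce
  show ?case
  proof (cases "T = U")
    case True
    have "0 \<le> K * ((\<Sum>i\<in>U. \<bar>f i\<bar>) / sqrt m)" using \<open>K \<ge> 0\<close> by (simp add: sum_nonneg)
    then show ?thesis using 1 True by (simp add: distrib_left)
  next
    case False
    define \<nu> where "\<nu> = (\<Sum>i\<in>T. \<bar>f i\<bar>) / m"
    have cT: "card T = m" using T False by simp
    have \<nu>: "\<bar>f j\<bar> \<le> \<nu>" if "j \<in> U - T" for j
    proof -
      have "real m * \<bar>f j\<bar> = (\<Sum>i\<in>T. \<bar>f j\<bar>)" using cT by simp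
      also have "\<dots> \<le> (\<Sum>i\<in>T. \<bar>f i\<bar>)" using T that by (intro sum_mono) auto
      finally show ?thesis using m by (simp add: \<nu>_def field_simps)
    qed
    have "\<nu> \<ge> 0" by (simp add: \<nu>_def sum_nonneg)
    have "card (U - T) < card U"
    proof (rule psubset_card_mono)
      have "T \<noteq> {}" using m cT by auto
      then show "U - T \<subset> U" using T by blast
    qed fact
    then have "\<Phi> (U - T) \<le> K * (sqrt m * \<nu> + (\<Sum>i\<in>U - T. \<bar>f i\<bar>) / sqrt m)"
      using less.prems \<nu> \<open>\<nu> \<ge> 0\<close> by (intro less.hyps) auto
    \<comment> \<open>The leading term of the bound for \<open>U - T\<close> is thus the share of
      \<open>T\<close> in the l1 sum, so only the initial \<open>\<mu>\<close> is left over.\<close>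
    moreover have "sqrt m * \<nu> = (\<Sum>i\<in>T. \<bar>f i\<bar>) / sqrt m"
      using m by (simp add: \<nu>_def field_simps)
    moreover have "(\<Sum>i\<in>U. \<bar>f i\<bar>) = (\<Sum>i\<in>U - T. \<bar>f i\<bar>) + (\<Sum>i\<in>T. \<bar>f i\<bar>)"
      using sum.subset_diff[OF T(1) less.prems(1)] .
    moreover have "\<Phi> U \<le> \<Phi> T + \<Phi> (U - T)"
      using sub[of T "U - T"] T by (simp add: Un_absorb1)
    ultimately show ?thesis using 1 by (simp add: distrib_left add_divide_distrib)
  qed
qed

text \<open>Restricted vectors stay in the full space, so that \<open>X *v\<close>, norms and sums
  of pieces with different supports need no change of index type.\<close>

definition vrestrict :: "'p set \<Rightarrow> real ^ 'p \<Rightarrow> real ^ 'p" where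
  "vrestrict T h = (\<chi> i. if i \<in> T then h $ i else 0)"

lemma vrestrict_nth [simp]: "vrestrict T h $ i = (if i \<in> T then h $ i else 0)"
  by (simp add: vrestrict_def)

lemma norm_vrestrict: "norm (vrestrict T h) = L2_set (($) h) T"
proof -
  have "(\<Sum>i\<in>UNIV. (if i \<in> T then h $ i else 0)\<^sup>2) = (\<Sum>i\<in>T. (h $ i)\<^sup>2)"
    by (rule sum.mono_neutral_cong_right) auto
  then show ?thesis by (simp add: norm_vec_def L2_set_def)
qed

lemma vrestrict_Un_disjoint: "A \<inter> B = {} \<Longrightarrow> vrestrict (A \<union> B) h = vrestrict A h + vrestrict B h"
  by (auto simp: vec_eq_iff)

lemma norm_vrestrict_mono: "A \<subseteq> B \<Longrightarrow> norm (vrestrict A h) \<le> norm (vrestrict B h)"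
  unfolding norm_vrestrict L2_set_def by (simp add: sum_mono2)

lemma vrestrict_UNIV [simp]: "vrestrict UNIV h = h"
  by (simp add: vec_eq_iff)

lemma l1_norm_triangle: "l1_norm (x + y) \<le> l1_norm x + l1_norm y"
  unfolding l1_norm_def sum.distrib[symmetric] by (intro sum_mono) simp

lemma l1_norm_le_norm:
  assumes "card T \<le> m" "\<And>i. i \<notin> T \<Longrightarrow> w $ i = 0"
  shows "l1_norm w \<le> sqrt m * norm w"
proof -
  have "l1_norm w = (\<Sum>i\<in>T. \<bar>w $ i\<bar>)"
    unfolding l1_norm_def using assms by (intro sum.mono_neutral_right) auto
  also have "\<dots> \<le> sqrt m * norm (vrestrict T w)"
    unfolding norm_vrestrict by (rule sum_abs_le_L2_set) fact
  also have "vrestrict T w = w" using assms by (auto simp: vec_eq_iff)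
  finally show ?thesis .
qed

lemma inner_matrix_mult:
  fixes X :: "real ^ 'p ^ 'n"
  shows "(X *v w) \<bullet> y = (\<Sum>j\<in>UNIV. w $ j * (column j X \<bullet> y))"
  by (simp add: matrix_mult_sum inner_sum_left vector_scalar_mult_def
      scalar_mult_eq_scaleR)

section \<open>Consequences of restricted isometry\<close>

text \<open>Isolates the inequalities behind the two constants, stated for vectors with small
  support, so that the deterministic argument never meets \<open>LEAST\<close>. The theorem
  instantiates it through \<open>ric_bounds\<close> and \<open>roc_bounds\<close>.\<close>

locale restricted_isometry =
  fixes X :: "real ^ 'p ^ 'n" and S :: nat and \<delta> \<theta> :: real
  assumes lower: "\<And>T w. card T \<le> 2 * S \<Longrightarrow> (\<And>i. i \<notin> T \<Longrightarrow> w $ i = 0) \<Longrightarrow>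
      (1 - \<delta>) * (norm w)\<^sup>2 \<le> (norm (X *v w))\<^sup>2"
    and upper: "\<And>T w. card T \<le> 2 * S \<Longrightarrow> (\<And>i. i \<notin> T \<Longrightarrow> w $ i = 0) \<Longrightarrow>
      (norm (X *v w))\<^sup>2 \<le> (1 + \<delta>) * (norm w)\<^sup>2"
    and ortho: "\<And>T T' w w'. T \<inter> T' = {} \<Longrightarrow> card T \<le> S \<Longrightarrow> card T' \<le> 2 * S \<Longrightarrow>
      (\<And>i. i \<notin> T \<Longrightarrow> w $ i = 0) \<Longrightarrow> (\<And>i. i \<notin> T' \<Longrightarrow> w' $ i = 0) \<Longrightarrow>
      \<bar>(X *v w) \<bullet> (X *v w')\<bar> \<le> \<theta> * norm w * norm w'"
    and \<delta>_nonneg: "\<delta> \<ge> 0" and \<theta>_nonneg: "\<theta> \<ge> 0" and less_1: "\<delta> + \<theta> < 1"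
begin

section \<open>The Gram matrix of the columns: bounds and inversion on small index sets\<close>

abbreviation corr :: "real ^ 'p \<Rightarrow> 'p \<Rightarrow> real" where
  "corr w j \<equiv> column j X \<bullet> (X *v w)"

lemma corr_add: "corr (v + w) j = corr v j + corr w j"
  by (simp add: matrix_vector_right_distrib inner_add_right)

text \<open>Duality: pairing the correlations on \<open>T\<close> with themselves turns their l2
  norm into an inner product of two images under \<open>X\<close>, to which isometry or
  orthogonality applies.\<close>

lemma L2_set_corr_eq:
  defines "v T w \<equiv> \<chi> j. if j \<in> T then corr w j else 0"
  shows "L2_set (corr w) T = norm (v T w)"
    and "(norm (v T w))\<^sup>2 = (X *v v T w) \<bullet> (X *v w)"
proof -
  have *: "(\<Sum>j\<in>UNIV. (if j \<in> T then corr w j else 0)\<^sup>2) = (\<Sum>j\<in>T. (corr w j)\<^sup>2)"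
    by (rule sum.mono_neutral_cong_right) auto
  then show "L2_set (corr w) T = norm (v T w)"
    by (simp add: norm_vec_def L2_set_def v_def)
  have "(norm (v T w))\<^sup>2 = (\<Sum>j\<in>UNIV. (if j \<in> T then corr w j else 0)\<^sup>2)"
    by (simp add: v_def norm_vec_def L2_set_def sum_nonneg)
  also have "\<dots> = (\<Sum>j\<in>UNIV. v T w $ j * corr w j)"
    by (intro sum.cong) (auto simp: v_def power2_eq_square)
  also have "\<dots> = (X *v v T w) \<bullet> (X *v w)" by (simp add: inner_matrix_mult)
  finally show "(norm (v T w))\<^sup>2 = (X *v v T w) \<bullet> (X *v w)" .
qed

text \<open>The index sets may overlap here, so Cauchy-Schwarz is used and each of the two images
  costs a factor \<open>sqrt (1 + \<delta>)\<close>.\<close>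

lemma L2_set_corr_le:
  assumes "card T \<le> S" "card T' \<le> S" "\<And>i. i \<notin> T' \<Longrightarrow> w $ i = 0"
  shows "L2_set (corr w) T \<le> (1 + \<delta>) * norm w"
proof -
  define v :: "real ^ 'p" where "v = (\<chi> j. if j \<in> T then corr w j else 0)"
  have "(norm v)\<^sup>2 \<le> norm (X *v v) * norm (X *v w)"
    using L2_set_corr_eq(2)[of T w] norm_cauchy_schwarz[of "X *v v" "X *v w"] by (simp add: v_def)
  also have "\<dots> \<le> (sqrt (1 + \<delta>) * norm v) * (sqrt (1 + \<delta>) * norm w)"
  proof (intro mult_mono)
    show "norm (X *v v) \<le> sqrt (1 + \<delta>) * norm v"
      using real_sqrt_le_mono[OF upper[of T v]] assms \<delta>_nonneg by (simp add: v_def real_sqrt_mult)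
    show "norm (X *v w) \<le> sqrt (1 + \<delta>) * norm w"
      using real_sqrt_le_mono[OF upper[of T' w]] assms \<delta>_nonneg by (simp add: real_sqrt_mult)
  qed (use \<delta>_nonneg in auto)
  also have "\<dots> = (1 + \<delta>) * norm w * norm v"
    using \<delta>_nonneg by (simp add: field_simps)
  finally have "norm v \<le> (1 + \<delta>) * norm w"
    using \<delta>_nonneg by (cases "v = 0") (auto simp: power2_eq_square)
  then show ?thesis using L2_set_corr_eq(1)[of w T] by (simp add: v_def)
qed

text \<open>For disjoint sets restricted orthogonality replaces Cauchy-Schwarz and gives the smaller
  factor \<open>\<theta>\<close>.\<close>

lemma L2_set_corr_disjoint_le:
  assumes "card T \<le> S" "card T' \<le> 2 * S" "T \<inter> T' = {}" "\<And>i. i \<notin> T' \<Longrightarrow> w $ i = 0"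
  shows "L2_set (corr w) T \<le> \<theta> * norm w"
proof -
  define v :: "real ^ 'p" where "v = (\<chi> j. if j \<in> T then corr w j else 0)"
  have "(norm v)\<^sup>2 \<le> \<theta> * norm v * norm w"
    using L2_set_corr_eq(2)[of T w] ortho[of T T' v w] assms by (simp add: v_def)
  then have "norm v \<le> \<theta> * norm w"
    using \<theta>_nonneg by (cases "v = 0") (auto simp: power2_eq_square)
  then show ?thesis using L2_set_corr_eq(1)[of w T] by (simp add: v_def)
qed

text \<open>The Gram matrix of the columns in \<open>T\<close> is positive definite with least
  eigenvalue at least \<open>1 - \<delta> > 0\<close>, hence invertible. Testing the equation
  against its solution bounds the solution.\<close>

lemma solve_on:
  assumes T: "card T \<le> S"
  obtains w where "\<And>i. i \<notin> T \<Longrightarrow> w $ i = 0" "\<And>j. j \<in> T \<Longrightarrow> corr w j = f j"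
    "(1 - \<delta>) * norm w \<le> L2_set f T"
proof -
  \<comment> \<open>Extending the Gram matrix of \<open>T\<close> by the identity outside
    \<open>T\<close> gives an endomorphism of the whole space, for which injectivity implies
    surjectivity.\<close>
  define L where "L w = (\<chi> j. if j \<in> T then corr (vrestrict T w) j else w $ j)" for w
  have add: "vrestrict T (v + w) = vrestrict T v + vrestrict T w" for v w :: "real ^ 'p"
    by (simp add: vec_eq_iff)
  have scale: "vrestrict T (c *\<^sub>R w) = c *\<^sub>R vrestrict T w" for c and w :: "real ^ 'p"
    by (simp add: vec_eq_iff)
  have lin: "linear L"
    by (rule linearI) (auto simp: L_def vec_eq_iff add scale corr_add matrix_vector_mult_scaleR)
  have lowT: "(1 - \<delta>) * (norm w)\<^sup>2 \<le> (\<Sum>j\<in>T. w $ j * corr w j)" if "\<And>i. i \<notin> T \<Longrightarrow> w $ i = 0" for w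
  proof -
    have "(1 - \<delta>) * (norm w)\<^sup>2 \<le> (norm (X *v w))\<^sup>2" using T that by (intro lower[of T]) auto
    also have "\<dots> = (\<Sum>j\<in>UNIV. w $ j * corr w j)"
      by (simp add: power2_norm_eq_inner inner_matrix_mult)
    also have "\<dots> = (\<Sum>j\<in>T. w $ j * corr w j)"
      using that by (intro sum.mono_neutral_right) auto
    finally show ?thesis .
  qed
  have "inj L"
  proof (subst linear_injective_0[OF lin], intro allI impI)
    fix w assume "L w = 0"
    then have *: "(if j \<in> T then corr (vrestrict T w) j else w $ j) = 0" for j
      by (simp add: L_def vec_eq_iff)
    have 1: "j \<in> T \<Longrightarrow> corr (vrestrict T w) j = 0" and 2: "j \<notin> T \<Longrightarrow> w $ j = 0" for j
      using *[of j] by simp_all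
    have eq: "vrestrict T w = w" using 2 by (auto simp: vec_eq_iff)
    have "(1 - \<delta>) * (norm w)\<^sup>2 \<le> 0" using lowT[OF 2] 1 eq by simp
    then show "w = 0" using less_1 \<theta>_nonneg by (simp add: mult_le_0_iff)
  qed
  then have "surj L" using lin linear_injective_imp_surjective by blast
  then obtain w where w: "L w = (\<chi> j. if j \<in> T then f j else 0)" by (metis surjD)
  then have *: "(if j \<in> T then corr (vrestrict T w) j else w $ j) = (if j \<in> T then f j else 0)" for j
    by (simp add: L_def vec_eq_iff)
  have 1: "j \<in> T \<Longrightarrow> corr (vrestrict T w) j = f j" and 2: "j \<notin> T \<Longrightarrow> w $ j = 0" for j
    using *[of j] by simp_all
  have eq: "vrestrict T w = w" using 2 by (auto simp: vec_eq_iff)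
  have "(1 - \<delta>) * (norm w)\<^sup>2 \<le> (\<Sum>j\<in>T. w $ j * f j)" using lowT[OF 2] 1 eq by simp
  also have "\<dots> \<le> (\<Sum>j\<in>T. \<bar>w $ j\<bar> * \<bar>f j\<bar>)" by (intro sum_mono) (simp add: abs_mult[symmetric])
  also have "\<dots> \<le> L2_set (($) w) T * L2_set f T" by (rule L2_set_mult_ineq)
  also have "L2_set (($) w) T = norm w" using norm_vrestrict[of T w] eq by simp
  finally have "(1 - \<delta>) * norm w \<le> L2_set f T"
    by (cases "w = 0") (auto simp: power2_eq_square)
  then show thesis using that[of w] 1 2 eq by simp
qed

text \<open>
  Correct \<open>w\<close> by a vector supported on the \<open>m\<close> largest remaining correlations that cancels
  them; the correlations this creates elsewhere are smaller by the factor \<open>\<theta> / (1 - \<delta>)\<close>.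
\<close>

lemma correction_step:
  fixes u :: "'p \<Rightarrow> real"
  assumes m: "1 \<le> m" "m \<le> S"
  obtains T w where "card T \<le> m" "\<And>i. i \<notin> T \<Longrightarrow> w $ i = 0" "\<And>j. j \<in> T \<Longrightarrow> u j + corr w j = 0"
    "(1 - \<delta>) * norm w \<le> L2_set u T" "\<And>j. j \<notin> T \<Longrightarrow> sqrt m * \<bar>u j\<bar> \<le> L2_set u T"
proof -
  obtain T where T: "card T \<le> m" "T \<noteq> UNIV \<longrightarrow> card T = m" "\<forall>i\<in>T. \<forall>j\<in>UNIV - T. \<bar>u j\<bar> \<le> \<bar>u i\<bar>"
    using top_entries[of UNIV m "\<lambda>j. \<bar>u j\<bar>"] by auto
  obtain w where w: "\<And>i. i \<notin> T \<Longrightarrow> w $ i = 0" "\<And>j. j \<in> T \<Longrightarrow> corr w j = - u j"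
    "(1 - \<delta>) * norm w \<le> L2_set (\<lambda>j. - u j) T"
    using solve_on[of T "\<lambda>j. - u j"] T m by (metis le_trans)
  \<comment> \<open>If an index lies outside \<open>T\<close>, then \<open>T\<close> has exactly
    \<open>m\<close> elements, and at each of them \<open>u\<close> is at least as large in modulus
    as at \<open>j\<close>.\<close>
  have "sqrt m * \<bar>u j\<bar> \<le> L2_set u T" if "j \<notin> T" for j
  proof -
    have "sqrt m * \<bar>u j\<bar> = L2_set (\<lambda>_. \<bar>u j\<bar>) T"
      using T that by (auto simp: L2_set_constant)
    also have "\<dots> \<le> L2_set (\<lambda>i. \<bar>u i\<bar>) T" using T that by (intro L2_set_mono) auto
    finally show ?thesis by (simp add: L2_set_def)
  qed
  then show thesis using that[of T w] T(1) w by (simp add: L2_set_def)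
qed

text \<open>Result of \<open>N\<close> correction steps. Each shrinks the norm of the corrector by
  \<open>\<theta> / (1 - \<delta>) < 1\<close>; summing the geometric series gives the two constants
  with denominator \<open>1 - \<delta> - \<theta>\<close>, and the term with the power
  \<open>N\<close> is what remains uncancelled. On \<open>T\<close> the value 0 stands for
  correlations which \<open>w\<close> itself has cancelled earlier. Correctors have at most
  \<open>m\<close> nonzero entries, so their l1 norms cost a factor \<open>sqrt m\<close>.\<close>

lemma correction:
  assumes m: "1 \<le> m" "m \<le> S" and "card T \<le> m" "\<And>i. i \<notin> T \<Longrightarrow> w $ i = 0"
  shows "\<exists>b. norm b \<le> \<theta> / (1 - \<delta> - \<theta>) * norm w \<and> l1_norm b \<le> sqrt m * (\<theta> / (1 - \<delta> - \<theta>) * norm w) \<and>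
    (\<forall>j. sqrt m * \<bar>(if j \<in> T then 0 else corr w j) + corr b j\<bar>
       \<le> \<theta> * (1 - \<delta>) / (1 - \<delta> - \<theta>) * norm w + sqrt m * (\<theta> / (1 - \<delta>)) ^ N * \<theta> * norm w)"
  using assms(3,4)
proof (induction N arbitrary: T w)
  case 0
  \<comment> \<open>Without a further step, indices are bounded one at a time instead of by an
    average over \<open>m\<close> entries; hence the extra \<open>sqrt m\<close> in the residual
    term.\<close>
  have "\<bar>if j \<in> T then 0 else corr w j\<bar> \<le> \<theta> * norm w" for j
  proof (cases "j \<in> T")
    case False
    then have "L2_set (corr w) {j} \<le> \<theta> * norm w"
      using m 0 by (intro L2_set_corr_disjoint_le[of _ T]) auto
    then show ?thesis using False by simp
  qed (use \<theta>_nonneg in simp)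
  then have "sqrt m * \<bar>if j \<in> T then 0 else corr w j\<bar> \<le> sqrt m * (\<theta> * norm w)" for j
    by (intro mult_left_mono) auto
  moreover have nn': "0 \<le> \<theta> * (1 - \<delta>) / (1 - \<delta> - \<theta>) * norm w"
    and nn: "0 \<le> \<theta> / (1 - \<delta> - \<theta>) * norm w"
    using \<theta>_nonneg less_1 by (auto intro!: divide_nonneg_nonneg mult_nonneg_nonneg)
  ultimately have "sqrt m * \<bar>if j \<in> T then 0 else corr w j\<bar>
    \<le> \<theta> * (1 - \<delta>) / (1 - \<delta> - \<theta>) * norm w + sqrt m * (\<theta> / (1 - \<delta>)) ^ 0 * \<theta> * norm w" for j
    using add_increasing[OF nn'] by (simp only: power_0 mult_1_right mult.assoc[of "sqrt m"])
  moreover have "l1_norm 0 \<le> sqrt m * (\<theta> / (1 - \<delta> - \<theta>) * norm w)"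
    using mult_nonneg_nonneg[OF _ nn, of "sqrt m"] by (simp add: l1_norm_def)
  ultimately show ?case using nn
    by (intro exI[of _ 0] conjI allI) (simp_all only: norm_zero matrix_vector_mult_0_right
        inner_zero_right add_0_right)
next
  case (Suc N)
  define D where "D = 1 - \<delta> - \<theta>"
  define \<rho> where "\<rho> = \<theta> / (1 - \<delta>)"
  define E where "E = \<theta> * (1 - \<delta>) / D"
  have D: "D > 0" "1 - \<delta> = D + \<theta>" using less_1 by (auto simp: D_def)
  \<comment> \<open>Fixed point equations of the geometric series: the first summand is the present
    step, the second the bound from the induction hypothesis for \<open>w'\<close>.\<close>
  have \<rho>: "\<rho> \<ge> 0" "\<theta> + E * \<rho> = E" "\<rho> + \<theta> / D * \<rho> = \<theta> / D"
    using D(1) \<theta>_nonneg unfolding E_def \<rho>_def D(2)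
    by (auto simp: add_pos_nonneg add_nonneg_eq_0_iff field_simps)
  define u where "u j = (if j \<in> T then 0 else corr w j)" for j
  obtain T' w' where T': "card T' \<le> m" "\<And>i. i \<notin> T' \<Longrightarrow> w' $ i = 0"
    "\<And>j. j \<in> T' \<Longrightarrow> u j + corr w' j = 0"
    "(1 - \<delta>) * norm w' \<le> L2_set u T'" "\<And>j. j \<notin> T' \<Longrightarrow> sqrt m * \<bar>u j\<bar> \<le> L2_set u T'"
    using correction_step[OF m, of u] by blast
  \<comment> \<open>Since \<open>u\<close> vanishes on \<open>T\<close>, only the part of
    \<open>T'\<close> disjoint from the support of \<open>w\<close> counts, and orthogonality
    applies.\<close>
  have "(\<Sum>j\<in>T'. (u j)\<^sup>2) = (\<Sum>j\<in>T' - T. (corr w j)\<^sup>2)"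
    by (rule sum.mono_neutral_cong_right) (auto simp: u_def)
  then have "L2_set u T' = L2_set (corr w) (T' - T)" by (simp add: L2_set_def)
  also have "\<dots> \<le> \<theta> * norm w"
    using m Suc.prems T'(1) card_mono[of T' "T' - T"]
    by (intro L2_set_corr_disjoint_le[of _ T]) auto
  finally have u: "L2_set u T' \<le> \<theta> * norm w" .
  have "norm w' * (1 - \<delta>) \<le> \<theta> * norm w" using T'(4) u by (simp add: mult.commute)
  moreover have "1 - \<delta> > 0" using D \<theta>_nonneg by simp
  ultimately have w': "norm w' \<le> \<rho> * norm w" by (simp add: \<rho>_def pos_le_divide_eq)
  obtain b where b: "norm b \<le> \<theta> / D * norm w'" "l1_norm b \<le> sqrt m * (\<theta> / D * norm w')"
    "\<And>j. sqrt m * \<bar>(if j \<in> T' then 0 else corr w' j) + corr b j\<bar>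
       \<le> E * norm w' + sqrt m * \<rho> ^ N * \<theta> * norm w'"
    using Suc.IH[OF T'(1,2)] by (auto simp: D_def E_def \<rho>_def)
  have *: "norm w' + \<theta> / D * norm w' \<le> \<theta> / D * norm w"
  proof -
    have "(1 + \<theta> / D) * norm w' \<le> (1 + \<theta> / D) * (\<rho> * norm w)"
      using w' D \<theta>_nonneg by (intro mult_left_mono) auto
    also have "\<dots> = (\<rho> + \<theta> / D * \<rho>) * norm w" by (simp add: algebra_simps)
    finally show ?thesis unfolding \<rho>(3) by (simp add: algebra_simps)
  qed
  have "norm (w' + b) \<le> \<theta> / D * norm w"
    using b(1) * norm_triangle_ineq[of w' b] by linarith
  moreover have "l1_norm (w' + b) \<le> sqrt m * (\<theta> / D * norm w)"
  proof -
    have "l1_norm (w' + b) \<le> sqrt m * norm w' + sqrt m * (\<theta> / D * norm w')"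
      using l1_norm_triangle[of w' b] l1_norm_le_norm[OF T'(1,2)] b(2) by linarith
    also have "\<dots> \<le> sqrt m * (\<theta> / D * norm w)"
      unfolding distrib_left[symmetric] using * by (intro mult_left_mono) auto
    finally show ?thesis .
  qed
  moreover have "sqrt m * \<bar>u j + corr (w' + b) j\<bar> \<le> E * norm w + sqrt m * \<rho> ^ Suc N * \<theta> * norm w" for j
  proof -
    \<comment> \<open>On \<open>T'\<close> the new corrector cancels \<open>u\<close>. Elsewhere
      \<open>u\<close> is small by the choice of \<open>T'\<close>, and the second bracket is what
      the induction hypothesis controls.\<close>
    have "u j + corr (w' + b) j = (if j \<in> T' then 0 else u j) + ((if j \<in> T' then 0 else corr w' j) + corr b j)"
      using T'(3)[of j] by (auto simp: corr_add)
    then have "sqrt m * \<bar>u j + corr (w' + b) j\<bar> \<le> sqrt m * (\<bar>if j \<in> T' then 0 else u j\<bar>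
        + \<bar>(if j \<in> T' then 0 else corr w' j) + corr b j\<bar>)"
      by (intro mult_left_mono) (auto intro: abs_triangle_ineq)
    also have "\<dots> \<le> \<theta> * norm w + (E * norm w' + sqrt m * \<rho> ^ N * \<theta> * norm w')"
      unfolding distrib_left
    proof (rule add_mono)
      show "sqrt m * \<bar>if j \<in> T' then 0 else u j\<bar> \<le> \<theta> * norm w"
        using T'(5)[of j] u \<theta>_nonneg by (cases "j \<in> T'") auto
    qed (use b(3) in blast)
    also have "\<dots> \<le> \<theta> * norm w + (E * (\<rho> * norm w) + sqrt m * \<rho> ^ N * \<theta> * (\<rho> * norm w))"
      using w' D \<theta>_nonneg \<rho>(1) by (intro add_mono mult_left_mono order_refl) (auto simp: E_def)
    also have "\<dots> = (\<theta> + E * \<rho>) * norm w + sqrt m * \<rho> ^ Suc N * \<theta> * norm w"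
      by (simp add: algebra_simps)
    finally show ?thesis unfolding \<rho>(2) .
  qed
  ultimately show ?case unfolding D_def[symmetric] E_def[symmetric] \<rho>_def[symmetric] u_def
    by blast
qed

text \<open>Serves to replace \<open>w\<close>, with up to \<open>S\<close> nonzero entries, by
  \<open>- b\<close> with l1 norm of order \<open>sqrt m\<close>, while \<open>w + b\<close> has
  small correlations. One step cancels the \<open>m\<close> largest correlations of
  \<open>w\<close>, \<open>correction\<close> treats those created by it, and a compactness argument
  removes the residual.\<close>

lemma decomposition:
  assumes m: "1 \<le> m" "m \<le> S" and T: "card T \<le> S" "\<And>i. i \<notin> T \<Longrightarrow> w $ i = 0"
  defines "A \<equiv> (1 + \<delta>) / (1 - \<delta> - \<theta>)"
  obtains b where "norm b \<le> A * norm w" "l1_norm b \<le> sqrt m * (A * norm w)"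
    "\<And>j. sqrt m * \<bar>corr w j + corr b j\<bar> \<le> (1 - \<delta>) * A * norm w"
proof -
  define D where "D = 1 - \<delta> - \<theta>"
  define \<rho> where "\<rho> = \<theta> / (1 - \<delta>)"
  define E where "E = \<theta> * (1 - \<delta>) / D"
  have D: "D > 0" "1 - \<delta> = D + \<theta>" using less_1 by (auto simp: D_def)
  obtain T' w' where T': "card T' \<le> m" "\<And>i. i \<notin> T' \<Longrightarrow> w' $ i = 0"
    "\<And>j. j \<in> T' \<Longrightarrow> corr w j + corr w' j = 0"
    "(1 - \<delta>) * norm w' \<le> L2_set (corr w) T'"
    "\<And>j. j \<notin> T' \<Longrightarrow> sqrt m * \<bar>corr w j\<bar> \<le> L2_set (corr w) T'"
    using correction_step[OF m, of "corr w"] by blast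
  \<comment> \<open>\<open>T'\<close> may meet the support of \<open>w\<close>, so this first step
    pays \<open>1 + \<delta>\<close> rather than \<open>\<theta>\<close>.\<close>
  have u: "L2_set (corr w) T' \<le> (1 + \<delta>) * norm w"
    using m T T'(1) by (intro L2_set_corr_le[of _ T]) auto
  have "norm w' * (1 - \<delta>) \<le> (1 + \<delta>) * norm w" using T'(4) u by (simp add: mult.commute)
  moreover have "1 - \<delta> > 0" using D \<theta>_nonneg by simp
  ultimately have w': "norm w' \<le> (1 + \<delta>) / (1 - \<delta>) * norm w"
    by (simp add: pos_le_divide_eq)
  \<comment> \<open>Totals of the first step and all later ones: norms of the correctors, then
    correlations.\<close>
  have A: "(1 + \<theta> / D) * ((1 + \<delta>) / (1 - \<delta>)) = A" "1 + \<delta> + E * ((1 + \<delta>) / (1 - \<delta>)) = (1 - \<delta>) * A"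
  proof -
    have "1 - \<delta> > 0" using D \<theta>_nonneg by simp
    moreover have "1 + \<theta> / D = (1 - \<delta>) / D" using D by (simp add: field_simps)
    ultimately show "(1 + \<theta> / D) * ((1 + \<delta>) / (1 - \<delta>)) = A" by (simp add: A_def D_def)
    have "E * ((1 + \<delta>) / (1 - \<delta>)) = \<theta> * (1 + \<delta>) / D"
      using \<open>1 - \<delta> > 0\<close> by (simp add: E_def)
    moreover have "(1 - \<delta>) * A = (D + \<theta>) * (1 + \<delta>) / D" using D(2) by (simp add: A_def D_def)
    ultimately show "1 + \<delta> + E * ((1 + \<delta>) / (1 - \<delta>)) = (1 - \<delta>) * A"
      using D(1) by (simp add: add_divide_distrib distrib_right)
  qed
  have *: "norm w' + \<theta> / D * norm w' \<le> A * norm w"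
  proof -
    have "(1 + \<theta> / D) * norm w' \<le> (1 + \<theta> / D) * ((1 + \<delta>) / (1 - \<delta>) * norm w)"
      using w' D \<theta>_nonneg by (intro mult_left_mono) auto
    then show ?thesis unfolding mult.assoc[symmetric] A(1) by (simp add: distrib_right)
  qed
  have "\<exists>b. norm b \<le> A * norm w \<and> l1_norm b \<le> sqrt m * (A * norm w) \<and>
    (\<forall>j. sqrt m * \<bar>corr w j + corr b j\<bar> \<le> (1 - \<delta>) * A * norm w + sqrt m * \<rho> ^ N * \<theta> * norm w')" for N
  proof -
    obtain b where b: "norm b \<le> \<theta> / D * norm w'" "l1_norm b \<le> sqrt m * (\<theta> / D * norm w')"
      "\<And>j. sqrt m * \<bar>(if j \<in> T' then 0 else corr w' j) + corr b j\<bar>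
         \<le> E * norm w' + sqrt m * \<rho> ^ N * \<theta> * norm w'"
      using correction[OF m T'(1,2), of N] by (auto simp: D_def E_def \<rho>_def)
    have "norm (w' + b) \<le> A * norm w"
      using b(1) * norm_triangle_ineq[of w' b] by linarith
    moreover have "l1_norm (w' + b) \<le> sqrt m * (A * norm w)"
    proof -
      have "l1_norm (w' + b) \<le> sqrt m * norm w' + sqrt m * (\<theta> / D * norm w')"
        using l1_norm_triangle[of w' b] l1_norm_le_norm[OF T'(1,2)] b(2) by linarith
      also have "\<dots> \<le> sqrt m * (A * norm w)"
        unfolding distrib_left[symmetric] using * by (intro mult_left_mono) auto
      finally show ?thesis .
    qed
    moreover have "sqrt m * \<bar>corr w j + corr (w' + b) j\<bar>
        \<le> (1 - \<delta>) * A * norm w + sqrt m * \<rho> ^ N * \<theta> * norm w'" for j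
    proof -
      have "corr w j + corr (w' + b) j
          = (if j \<in> T' then 0 else corr w j) + ((if j \<in> T' then 0 else corr w' j) + corr b j)"
        using T'(3)[of j] by (auto simp: corr_add)
      then have "sqrt m * \<bar>corr w j + corr (w' + b) j\<bar> \<le> sqrt m * (\<bar>if j \<in> T' then 0 else corr w j\<bar>
          + \<bar>(if j \<in> T' then 0 else corr w' j) + corr b j\<bar>)"
        by (intro mult_left_mono) (auto intro: abs_triangle_ineq)
      also have "\<dots> \<le> (1 + \<delta>) * norm w + (E * norm w' + sqrt m * \<rho> ^ N * \<theta> * norm w')"
        unfolding distrib_left
      proof (rule add_mono)
        show "sqrt m * \<bar>if j \<in> T' then 0 else corr w j\<bar> \<le> (1 + \<delta>) * norm w"
          using T'(5)[of j] u \<delta>_nonneg by (cases "j \<in> T'") auto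
      qed (use b(3) in blast)
      also have "\<dots> \<le> (1 + \<delta>) * norm w
          + (E * ((1 + \<delta>) / (1 - \<delta>) * norm w) + sqrt m * \<rho> ^ N * \<theta> * norm w')"
        using w' D \<theta>_nonneg by (intro add_mono mult_left_mono order_refl) (auto simp: E_def)
      also have "\<dots> = (1 + \<delta> + E * ((1 + \<delta>) / (1 - \<delta>))) * norm w + sqrt m * \<rho> ^ N * \<theta> * norm w'"
        by (simp add: distrib_right)
      finally show ?thesis unfolding A(2) .
    qed
    ultimately show ?thesis by blast
  qed
  then obtain b where b: "\<And>N. norm (b N) \<le> A * norm w" "\<And>N. l1_norm (b N) \<le> sqrt m * (A * norm w)"
    "\<And>N j. sqrt m * \<bar>corr w j + corr (b N) j\<bar> \<le> (1 - \<delta>) * A * norm w + sqrt m * \<rho> ^ N * \<theta> * norm w'"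
    by metis
  \<comment> \<open>The vectors \<open>b N\<close> lie in one ball, and a limit point satisfies the
    bounds without the residual, which tends to 0.\<close>
  obtain l r where l: "strict_mono r" "(b \<circ> r) \<longlonglongrightarrow> l"
  proof -
    have "compact (cball (0 :: real ^ 'p) (A * norm w))" by simp
    moreover have "\<forall>n. b n \<in> cball 0 (A * norm w)" using b(1) by simp
    ultimately show thesis using that unfolding compact_def by metis
  qed
  have lim: "(\<lambda>n. b (r n)) \<longlonglongrightarrow> l" using l(2) by (simp add: o_def)
  have "norm l \<le> A * norm w"
    using b(1) by (intro LIMSEQ_le_const2[OF tendsto_norm[OF lim]]) auto
  moreover have "l1_norm l \<le> sqrt m * (A * norm w)"
  proof (rule LIMSEQ_le_const2)
    show "(\<lambda>n. l1_norm (b (r n))) \<longlonglongrightarrow> l1_norm l"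
      unfolding l1_norm_def by (intro tendsto_intros lim)
  qed (use b(2) in auto)
  moreover have "sqrt m * \<bar>corr w j + corr l j\<bar> \<le> (1 - \<delta>) * A * norm w" for j
  proof (rule LIMSEQ_le)
    have "(\<lambda>n. X *v b (r n)) \<longlonglongrightarrow> X *v l"
      by (intro bounded_linear.tendsto[OF matrix_vector_mul_bounded_linear] lim)
    then show "(\<lambda>n. sqrt m * \<bar>corr w j + corr (b (r n)) j\<bar>) \<longlonglongrightarrow> sqrt m * \<bar>corr w j + corr l j\<bar>"
      by (intro tendsto_intros)
    have "(\<lambda>n. \<rho> ^ n) \<longlonglongrightarrow> 0"
      using D \<theta>_nonneg by (intro LIMSEQ_realpow_zero) (auto simp: \<rho>_def)
    then have "(\<lambda>n. \<rho> ^ r n) \<longlonglongrightarrow> 0" using LIMSEQ_subseq_LIMSEQ[OF _ l(1)] by (auto simp: o_def)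
    then have "(\<lambda>n. (1 - \<delta>) * A * norm w + sqrt m * \<rho> ^ r n * \<theta> * norm w') \<longlonglongrightarrow>
        (1 - \<delta>) * A * norm w + sqrt m * 0 * \<theta> * norm w'" by (intro tendsto_intros)
    then show "(\<lambda>n. (1 - \<delta>) * A * norm w + sqrt m * \<rho> ^ r n * \<theta> * norm w') \<longlonglongrightarrow>
        (1 - \<delta>) * A * norm w" by simp
  qed (use b(3) in auto)
  ultimately show thesis by (rule that)
qed

text \<open>Take for \<open>N\<close> the norm of \<open>h\<close> on \<open>T0\<close> together
  with its \<open>m\<close> largest entries elsewhere, and test \<open>X *v h\<close> against the
  image of this part. The correlations bound the product by
  \<open>N * (sqrt (2 * m) * \<Lambda>)\<close>; isometry bounds the diagonal term from below, and
  orthogonality with the blocks of the rest bounds the cross term.\<close>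

lemma cone:
  assumes m: "1 \<le> m" "m \<le> S" and T0: "card T0 \<le> m" and \<Lambda>: "\<And>j. \<bar>corr h j\<bar> \<le> \<Lambda>"
  defines "L \<equiv> \<Sum>i\<in>- T0. \<bar>h $ i\<bar>"
  obtains N where "norm (vrestrict T0 h) \<le> N" "norm h \<le> N + L / sqrt m"
    "(1 - \<delta>) * N \<le> sqrt (2 * m) * \<Lambda> + \<theta> * L / sqrt m"
proof -
  obtain T1 where T1: "T1 \<subseteq> - T0" "card T1 \<le> m" "T1 \<noteq> - T0 \<longrightarrow> card T1 = m"
    "\<forall>i\<in>T1. \<forall>j\<in>- T0 - T1. \<bar>h $ j\<bar> \<le> \<bar>h $ i\<bar>"
    using top_entries[of "- T0" m "\<lambda>j. \<bar>h $ j\<bar>"] by auto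
  define T where "T = T0 \<union> T1"
  define N where "N = norm (vrestrict T h)"
  define \<mu> where "\<mu> = (\<Sum>i\<in>T1. \<bar>h $ i\<bar>) / m"
  have cT: "card T \<le> 2 * m" using card_Un_le[of T0 T1] T0 T1 by (simp add: T_def)
  have \<mu>: "\<bar>h $ j\<bar> \<le> \<mu>" if "j \<in> - T" for j
  proof -
    have j: "j \<in> - T0 - T1" using that by (auto simp: T_def)
    then have "card T1 = m" using T1 by blast
    then have "real m * \<bar>h $ j\<bar> = (\<Sum>i\<in>T1. \<bar>h $ j\<bar>)" by simp
    also have "\<dots> \<le> (\<Sum>i\<in>T1. \<bar>h $ i\<bar>)" using T1 j by (intro sum_mono) auto
    finally show ?thesis using m by (simp add: \<mu>_def field_simps)
  qed
  have \<mu>0: "\<mu> \<ge> 0" by (simp add: \<mu>_def sum_nonneg)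
  \<comment> \<open>\<open>\<mu>\<close> is the average over \<open>T1\<close>, so the first term
    restores exactly the entries of \<open>T1\<close> missing from the sum over
    \<open>- T\<close>.\<close>
  have L: "sqrt m * \<mu> + (\<Sum>i\<in>- T. \<bar>h $ i\<bar>) / sqrt m = L / sqrt m"
  proof -
    have "sqrt m * \<mu> = (\<Sum>i\<in>T1. \<bar>h $ i\<bar>) / sqrt m" using m by (simp add: \<mu>_def field_simps)
    moreover have "L = (\<Sum>i\<in>- T0 - T1. \<bar>h $ i\<bar>) + (\<Sum>i\<in>T1. \<bar>h $ i\<bar>)"
      unfolding L_def by (rule sum.subset_diff) (use T1 in auto)
    moreover have "- T0 - T1 = - T" by (auto simp: T_def)
    ultimately show ?thesis by (simp add: add_divide_distrib)
  qed
  have compl: "vrestrict T h + vrestrict (- T) h = h"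
    using vrestrict_Un_disjoint[of T "- T" h] by simp
  \<comment> \<open>\<open>block_bound\<close> is used twice: here for the norm of the rest, then
    for its inner product with the image of the main part.\<close>
  have n_compl: "norm (vrestrict (- T) h) \<le> L / sqrt m"
    using block_bound[of "- T" m 1 "\<lambda>A. norm (vrestrict A h)" "($) h" \<mu>] m \<mu> \<mu>0 L
    by (auto simp: norm_vrestrict[symmetric] vrestrict_Un_disjoint norm_triangle_ineq)
  have cross: "\<bar>(X *v vrestrict T h) \<bullet> (X *v vrestrict (- T) h)\<bar> \<le> \<theta> * N * (L / sqrt m)"
  proof -
    have "\<bar>(X *v vrestrict T h) \<bullet> (X *v vrestrict (- T) h)\<bar>
      \<le> \<theta> * N * (sqrt m * \<mu> + (\<Sum>i\<in>- T. \<bar>h $ i\<bar>) / sqrt m)"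
    proof (rule block_bound[where \<Phi> = "\<lambda>A. \<bar>(X *v vrestrict T h) \<bullet> (X *v vrestrict A h)\<bar>"])
      fix A assume A: "A \<subseteq> - T" "card A \<le> m"
      have "\<bar>(X *v vrestrict A h) \<bullet> (X *v vrestrict T h)\<bar> \<le> \<theta> * norm (vrestrict A h) * N"
        unfolding N_def using A cT m by (intro ortho[of A T]) auto
      then show "\<bar>(X *v vrestrict T h) \<bullet> (X *v vrestrict A h)\<bar> \<le> \<theta> * N * L2_set (($) h) A"
        by (simp add: inner_commute norm_vrestrict mult.commute mult.left_commute)
    next
      fix A B :: "'p set" assume "A \<inter> B = {}"
      then show "\<bar>(X *v vrestrict T h) \<bullet> (X *v vrestrict (A \<union> B) h)\<bar>
          \<le> \<bar>(X *v vrestrict T h) \<bullet> (X *v vrestrict A h)\<bar>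
            + \<bar>(X *v vrestrict T h) \<bullet> (X *v vrestrict B h)\<bar>"
        by (simp add: vrestrict_Un_disjoint matrix_vector_right_distrib inner_add_right)
    qed (use m \<mu> \<mu>0 \<theta>_nonneg in \<open>auto simp: N_def\<close>)
    then show ?thesis unfolding L .
  qed
  have "\<bar>(X *v vrestrict T h) \<bullet> (X *v h)\<bar> \<le> N * (sqrt (2 * m) * \<Lambda>)"
  proof -
    have "(X *v vrestrict T h) \<bullet> (X *v h) = (\<Sum>j\<in>T. h $ j * corr h j)"
      unfolding inner_matrix_mult by (rule sum.mono_neutral_cong_right) auto
    also have "\<bar>\<dots>\<bar> \<le> (\<Sum>j\<in>T. \<bar>h $ j\<bar> * \<bar>corr h j\<bar>)"
      unfolding abs_mult[symmetric] by (rule sum_abs)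
    also have "\<dots> \<le> L2_set (($) h) T * L2_set (corr h) T" by (rule L2_set_mult_ineq)
    also have "\<dots> \<le> L2_set (($) h) T * (sqrt (real (2 * m)) * \<Lambda>)"
      using cT \<Lambda> order_trans[OF abs_ge_zero \<Lambda>] by (intro mult_left_mono L2_set_le_max) auto
    finally show ?thesis by (simp add: N_def norm_vrestrict)
  qed
  moreover have "(X *v vrestrict T h) \<bullet> (X *v h)
      = (norm (X *v vrestrict T h))\<^sup>2 + (X *v vrestrict T h) \<bullet> (X *v vrestrict (- T) h)"
    by (subst (2) compl[symmetric])
      (simp add: matrix_vector_right_distrib inner_add_right power2_norm_eq_inner)
  moreover have "(1 - \<delta>) * N\<^sup>2 \<le> (norm (X *v vrestrict T h))\<^sup>2"
    unfolding N_def using cT m by (intro lower[of T]) auto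
  ultimately have "(1 - \<delta>) * N\<^sup>2 \<le> N * (sqrt (2 * m) * \<Lambda>) + \<theta> * N * (L / sqrt m)"
    using cross by linarith
  then have "N * ((1 - \<delta>) * N) \<le> N * (sqrt (2 * m) * \<Lambda> + \<theta> * L / sqrt m)"
    by (simp add: power2_eq_square algebra_simps)
  moreover have "N \<ge> 0" by (simp add: N_def)
  moreover have "0 \<le> sqrt (2 * m) * \<Lambda> + \<theta> * L / sqrt m"
    using order_trans[OF abs_ge_zero \<Lambda>] \<theta>_nonneg by (simp add: L_def sum_nonneg)
  ultimately have "(1 - \<delta>) * N \<le> sqrt (2 * m) * \<Lambda> + \<theta> * L / sqrt m"
    by (cases "N = 0") auto
  moreover have "norm (vrestrict T0 h) \<le> N"
    unfolding N_def by (rule norm_vrestrict_mono) (auto simp: T_def)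
  moreover have "norm h \<le> N + L / sqrt m"
    using norm_triangle_ineq[of "vrestrict T h" "vrestrict (- T) h"] n_compl
    by (simp add: compl N_def)
  ultimately show thesis by (rule that[rotated 2])
qed

end

section \<open>The error on the event of small noise correlations\<close>

lemma infnorm_transpose_mult_le_iff:
  fixes X :: "real ^ 'p ^ 'n"
  shows "infnorm (transpose X *v y) \<le> c \<longleftrightarrow> (\<forall>j. \<bar>column j X \<bullet> y\<bar> \<le> c)"
proof -
  have *: "(transpose X *v y) $ j = column j X \<bullet> y" for j
    by (simp add: matrix_vector_mul_component transpose_def column_def)
  show ?thesis
  proof
    assume "infnorm (transpose X *v y) \<le> c"
    then show "\<forall>j. \<bar>column j X \<bullet> y\<bar> \<le> c"
      using component_le_infnorm_cart[of "transpose X *v y"] by (metis * order_trans)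
  next
    assume "\<forall>j. \<bar>column j X \<bullet> y\<bar> \<le> c"
    then show "infnorm (transpose X *v y) \<le> c"
      unfolding infnorm_cart by (intro cSup_least) (auto simp: * simp del: transpose_matrix_vector)
  qed
qed

lemma is_dantzig_selectorD:
  assumes "is_dantzig_selector X y lam \<sigma> b"
  shows "\<bar>column j X \<bullet> (y - X *v b)\<bar> \<le> lam * \<sigma>"
    and "(\<And>j. \<bar>column j X \<bullet> (y - X *v b')\<bar> \<le> lam * \<sigma>) \<Longrightarrow> l1_norm b \<le> l1_norm b'"
  using assms unfolding is_dantzig_selector_def is_arg_min_def infnorm_transpose_mult_le_iff
  by (auto simp: not_less)

text \<open>The left-hand side is the constant that the argument below produces.\<close>

lemma C2_bound:
  fixes \<delta> \<theta> :: real
  assumes "\<delta> \<ge> 0" "\<theta> \<ge> 0" "\<delta> + \<theta> < 1"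
  defines "A \<equiv> (1 + \<delta>) / (1 - \<delta> - \<theta>)"
  shows "2 * (2 * sqrt 2 + 2 * \<theta> * A) / (1 - \<delta> - \<theta>) + 3 * A + 1 \<le> C2_const \<delta> \<theta>"
proof -
  define D where "D = 1 - \<delta> - \<theta>"
  have D: "0 < D" "D \<le> 1" using assms by (auto simp: D_def)
  have A: "A \<ge> 1" using D assms by (simp add: A_def D_def field_simps)
  have q: "sqrt 2 \<ge> 1" by simp
  have i: "1 + 1 / sqrt 2 \<ge> 3 / 2"
    using real_sqrt_le_mono[of 2 4] by (simp add: field_simps)
  have AD: "A \<le> A / D" using A D by (simp add: le_divide_eq mult_le_cancel_left1)
  define Q where "Q = A / D"
  have Q: "Q \<ge> 1" "A \<le> Q" using A AD by (auto simp: Q_def)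
  define k where "k = 1 + 1 / sqrt 2"
  have "C0_const \<delta> \<theta> = 2 * sqrt 2 * (1 + (1 - \<delta>) * A) + k * ((1 + \<delta>) * A)"
    unfolding C0_const_def k_def A_def by (simp add: power2_eq_square algebra_simps)
  then have "C0_const \<delta> \<theta> / D = 2 * sqrt 2 / D + 2 * sqrt 2 * ((1 - \<delta>) * Q) + k * ((1 + \<delta>) * Q)"
    by (simp add: Q_def add_divide_distrib distrib_left)
  moreover have "C2_const \<delta> \<theta> = 2 * (C0_const \<delta> \<theta> / D) + 2 * (\<theta> * Q) + A"
    unfolding C2_const_def D_def[symmetric]
    by (simp add: Q_def A_def D_def[symmetric] power2_eq_square)
  moreover have "4 * ((1 - \<delta>) * Q) \<le> 4 * sqrt 2 * ((1 - \<delta>) * Q)"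
    using q Q assms by (intro mult_right_mono) auto
  moreover have "3 * ((1 + \<delta>) * Q) \<le> 2 * k * ((1 + \<delta>) * Q)"
    unfolding k_def using i Q assms by (intro mult_right_mono) auto
  ultimately have "4 * sqrt 2 / D + 4 * ((1 - \<delta>) * Q) + 3 * ((1 + \<delta>) * Q) + 2 * (\<theta> * Q) + A
      \<le> C2_const \<delta> \<theta>" by simp
  then have "4 * sqrt 2 / D + 4 * (Q - \<delta> * Q) + 3 * (Q + \<delta> * Q) + 2 * (\<theta> * Q) + A
      \<le> C2_const \<delta> \<theta>" by (simp only: left_diff_distrib distrib_right mult_1)
  \<comment> \<open>The left-hand side of the goal has \<open>2 * (\<theta> * Q)\<close>,
    \<open>2 * A\<close> and 1 in excess; these are paid from the multiples of \<open>Q\<close>, by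
    \<open>\<theta> \<le> 1 - \<delta>\<close>, \<open>A \<le> Q\<close> and
    \<open>1 \<le> Q\<close>.\<close>
  moreover have "\<theta> * Q \<le> (1 - \<delta>) * Q" using Q assms by (intro mult_right_mono) auto
  then have "\<theta> * Q \<le> Q - \<delta> * Q" by (simp add: left_diff_distrib)
  moreover have "0 \<le> \<delta> * Q" using Q assms by simp
  ultimately have "4 * sqrt 2 / D + 4 * (\<theta> * Q) + 3 * A + 1 \<le> C2_const \<delta> \<theta>" using Q by argo
  moreover have "2 * (2 * sqrt 2 + 2 * \<theta> * A) / D = 4 * sqrt 2 / D + 4 * (\<theta> * Q)"
    by (simp add: Q_def add_divide_distrib)
  ultimately show ?thesis unfolding D_def[symmetric] by simp
qed

context restricted_isometry
begin

text \<open>The slack \<open>\<tau> / (1 - \<delta> - \<theta>)\<close> in the noise bound is what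
  the competitor \<open>\<beta>1 - b0\<close> needs to be feasible. Its distance to \<open>b\<close>
  and its distance to \<open>\<beta>\<close> are both of order
  \<open>sqrt m * \<Lambda>\<close>.\<close>

lemma dantzig_selector_error:
  assumes S: "S \<ge> 1" and \<beta>: "card {i. \<beta> $ i \<noteq> 0} \<le> S" and "\<tau> > 0"
    and z: "\<And>j. \<bar>column j X \<bullet> v\<bar> + \<tau> / (1 - \<delta> - \<theta>) \<le> lam * \<sigma>"
    and sel: "is_dantzig_selector X (X *v \<beta> + v) lam \<sigma> b"
  shows "(norm (b - \<beta>))\<^sup>2
    \<le> (C2_const \<delta> \<theta>)\<^sup>2 * (lam * \<sigma>)\<^sup>2 * (1 + (\<Sum>i\<in>UNIV. min ((\<beta> $ i)\<^sup>2) (\<tau>\<^sup>2)) / \<tau>\<^sup>2)"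
proof -
  define D where "D = 1 - \<delta> - \<theta>"
  define A where "A = (1 + \<delta>) / D"
  define \<Lambda> where "\<Lambda> = lam * \<sigma>"
  define R where "R = (\<Sum>i\<in>UNIV. min ((\<beta> $ i)\<^sup>2) (\<tau>\<^sup>2))"
  \<comment> \<open>At least 1, since the block argument divides by \<open>sqrt m\<close>; at most
    \<open>S\<close>, since \<open>R \<le> S * \<tau>\<^sup>2\<close>. Rounding up costs the summand
    1 in the final bound.\<close>
  define m where "m = max 1 (nat \<lceil>R / \<tau>\<^sup>2\<rceil>)"
  have D: "0 < D" "D \<le> 1" using less_1 \<delta>_nonneg \<theta>_nonneg by (auto simp: D_def)
  have A: "A \<ge> 1" using D \<delta>_nonneg by (simp add: A_def field_simps)
  have "\<tau> \<le> \<tau> / D" using D \<open>\<tau> > 0\<close> by (simp add: field_simps)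
  \<comment> \<open>The noise bound holds for every column, so an arbitrary one shows this.\<close>
  then have \<Lambda>: "\<tau> \<le> \<Lambda>" using z[of undefined] by (simp add: D_def \<Lambda>_def)
  have "0 \<le> R" by (simp add: R_def sum_nonneg)
  have R: "R \<le> S * \<tau>\<^sup>2"
  proof -
    have "R = (\<Sum>i | \<beta> $ i \<noteq> 0. min ((\<beta> $ i)\<^sup>2) (\<tau>\<^sup>2))"
      unfolding R_def by (rule sum.mono_neutral_right) auto
    also have "\<dots> \<le> (\<Sum>i | \<beta> $ i \<noteq> 0. \<tau>\<^sup>2)" by (intro sum_mono) auto
    also have "\<dots> \<le> S * \<tau>\<^sup>2" using \<beta> by (simp add: mult_right_mono)
    finally show ?thesis .
  qed
  have m: "1 \<le> m" "m \<le> S" "R \<le> m * \<tau>\<^sup>2" "m \<le> 1 + R / \<tau>\<^sup>2"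
  proof -
    have x: "0 \<le> R / \<tau>\<^sup>2" "R / \<tau>\<^sup>2 \<le> S" using R \<open>0 \<le> R\<close> \<open>\<tau> > 0\<close> by (auto simp: divide_le_eq)
    show "1 \<le> m" by (simp add: m_def)
    show "m \<le> S" using S x by (simp add: m_def nat_le_iff ceiling_le_iff)
    have "R / \<tau>\<^sup>2 \<le> m" unfolding m_def by linarith
    then show "R \<le> m * \<tau>\<^sup>2" using \<open>\<tau> > 0\<close> by (simp add: divide_le_eq)
    show "m \<le> 1 + R / \<tau>\<^sup>2" using x unfolding m_def by linarith
  qed
  define T0 where "T0 = {i. \<bar>\<beta> $ i\<bar> > \<tau>}"
  have T0: "card T0 \<le> m"
  proof -
    have "card T0 * \<tau>\<^sup>2 = (\<Sum>i\<in>T0. min ((\<beta> $ i)\<^sup>2) (\<tau>\<^sup>2))"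
      using \<open>\<tau> > 0\<close> by (auto simp: T0_def min_def abs_le_square_iff[symmetric])
    also have "\<dots> \<le> R" unfolding R_def by (intro sum_mono2) auto
    finally have "card T0 * \<tau>\<^sup>2 \<le> m * \<tau>\<^sup>2" using m by simp
    then show ?thesis using \<open>\<tau> > 0\<close> by simp
  qed
  define \<beta>1 where "\<beta>1 = vrestrict T0 \<beta>"
  define \<beta>2 where "\<beta>2 = vrestrict (- T0) \<beta>"
  have \<beta>12: "\<beta> = \<beta>1 + \<beta>2" by (simp add: \<beta>1_def \<beta>2_def vec_eq_iff)
  have n2: "norm \<beta>2 \<le> sqrt m * \<tau>"
  proof -
    have "(norm \<beta>2)\<^sup>2 = (\<Sum>i\<in>- T0. (\<beta> $ i)\<^sup>2)"
      by (simp add: \<beta>2_def norm_vrestrict L2_set_def sum_nonneg)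
    also have "\<dots> = (\<Sum>i\<in>- T0. min ((\<beta> $ i)\<^sup>2) (\<tau>\<^sup>2))"
      using \<open>\<tau> > 0\<close> by (intro sum.cong) (auto simp: T0_def min_def abs_le_square_iff[symmetric])
    also have "\<dots> \<le> R" unfolding R_def by (intro sum_mono2) auto
    finally have "norm \<beta>2 \<le> sqrt (m * \<tau>\<^sup>2)" using m by (intro real_le_rsqrt) auto
    then show ?thesis using \<open>\<tau> > 0\<close> by (simp add: real_sqrt_mult)
  qed
  obtain b0 where b0: "norm b0 \<le> A * norm \<beta>2" "l1_norm b0 \<le> sqrt m * (A * norm \<beta>2)"
    "\<And>j. sqrt m * \<bar>corr \<beta>2 j + corr b0 j\<bar> \<le> (1 - \<delta>) * A * norm \<beta>2"
  proof -
    have "i \<notin> {i. \<beta> $ i \<noteq> 0} \<Longrightarrow> \<beta>2 $ i = 0" for i by (simp add: \<beta>2_def)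
    from decomposition[OF m(1,2) \<beta> this] that show thesis unfolding A_def D_def by blast
  qed
  have b0n: "norm b0 \<le> A * (sqrt m * \<tau>)" and b0l: "l1_norm b0 \<le> A * (real m * \<tau>)"
  proof -
    have *: "A * norm \<beta>2 \<le> A * (sqrt m * \<tau>)"
      by (rule mult_left_mono[OF n2]) (use A in simp)
    then show "norm b0 \<le> A * (sqrt m * \<tau>)" using b0(1) by simp
    have "sqrt m * (A * norm \<beta>2) \<le> sqrt m * (A * (sqrt m * \<tau>))"
      by (rule mult_left_mono[OF *]) simp
    then show "l1_norm b0 \<le> A * (real m * \<tau>)" using b0(2) by (simp add: algebra_simps)
  qed
  have b0c: "\<bar>corr \<beta>2 j + corr b0 j\<bar> \<le> \<tau> / D" for j
  proof -
    have c: "0 \<le> (1 - \<delta>) * A"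
      using A less_1 \<theta>_nonneg by (intro mult_nonneg_nonneg) auto
    \<comment> \<open>Here \<open>1 - \<delta>\<^sup>2 \<le> 1\<close> yields exactly the slack
      \<open>\<tau> / D\<close>.\<close>
    have "(1 - \<delta>) * A = (1 - \<delta>\<^sup>2) / D" by (simp add: A_def power2_eq_square algebra_simps)
    also have "\<dots> \<le> 1 / D" using D by (intro divide_right_mono) auto
    finally have c': "(1 - \<delta>) * A \<le> 1 / D" .
    have "sqrt m * \<bar>corr \<beta>2 j + corr b0 j\<bar> \<le> (1 - \<delta>) * A * (sqrt m * \<tau>)"
      using b0(3)[of j] mult_left_mono[OF n2 c] by simp
    also have "\<dots> \<le> 1 / D * (sqrt m * \<tau>)" using c' \<open>\<tau> > 0\<close> by (intro mult_right_mono) auto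
    also have "\<dots> = sqrt m * (\<tau> / D)" by simp
    finally show ?thesis by (rule mult_left_le_imp_le) (use m in simp)
  qed
  define h where "h = b - (\<beta>1 - b0)"
  have res: "column j X \<bullet> (X *v \<beta> + v - X *v (\<beta>1 - b0)) = column j X \<bullet> v + (corr \<beta>2 j + corr b0 j)" for j
    by (simp add: \<beta>12 algebra_simps)
  have feas: "\<bar>column j X \<bullet> (X *v \<beta> + v - X *v (\<beta>1 - b0))\<bar> \<le> \<Lambda>" for j
    unfolding res \<Lambda>_def using z[of j] b0c[of j] unfolding D_def by linarith
  \<comment> \<open>Both \<open>b\<close> and the competitor are feasible, so their residual
    correlations differ by at most twice the constraint level.\<close>
  have hc: "\<bar>corr h j\<bar> \<le> 2 * \<Lambda>" for j
  proof -
    have "corr h j = column j X \<bullet> (X *v \<beta> + v - X *v (\<beta>1 - b0)) - column j X \<bullet> (X *v \<beta> + v - X *v b)"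
      by (simp add: h_def algebra_simps)
    then show ?thesis using feas[of j] is_dantzig_selectorD(1)[OF sel, of j]
      unfolding \<Lambda>_def by linarith
  qed
  define L where "L = (\<Sum>i\<in>- T0. \<bar>h $ i\<bar>)"
  have L: "L \<le> (\<Sum>i\<in>T0. \<bar>h $ i\<bar>) + 2 * l1_norm b0"
  proof -
    have split: "l1_norm w = (\<Sum>i\<in>T0. \<bar>w $ i\<bar>) + (\<Sum>i\<in>- T0. \<bar>w $ i\<bar>)" for w :: "real ^ 'p"
      unfolding l1_norm_def using sum.union_disjoint[of T0 "- T0" "\<lambda>i. \<bar>w $ i\<bar>"] by simp
    have "l1_norm b \<le> l1_norm (\<beta>1 - b0)"
      using is_dantzig_selectorD(2)[OF sel] feas unfolding \<Lambda>_def by blast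
    moreover have "l1_norm b \<ge> l1_norm (\<beta>1 - b0) - (\<Sum>i\<in>T0. \<bar>h $ i\<bar>)
        + (\<Sum>i\<in>- T0. \<bar>h $ i\<bar>) - 2 * (\<Sum>i\<in>- T0. \<bar>b0 $ i\<bar>)"
    proof -
      have "(\<Sum>i\<in>T0. \<bar>b $ i\<bar>) \<ge> (\<Sum>i\<in>T0. \<bar>(\<beta>1 - b0) $ i\<bar> - \<bar>h $ i\<bar>)"
        by (intro sum_mono) (auto simp: h_def)
      \<comment> \<open>Off \<open>T0\<close> the competitor is \<open>- b0\<close> and
        \<open>b\<close> is \<open>h - b0\<close>, so \<open>b0\<close> is lost twice.\<close>
      moreover have "(\<Sum>i\<in>- T0. \<bar>b $ i\<bar>)
          \<ge> (\<Sum>i\<in>- T0. \<bar>(\<beta>1 - b0) $ i\<bar> + \<bar>h $ i\<bar> - 2 * \<bar>b0 $ i\<bar>)"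
        by (intro sum_mono) (auto simp: h_def \<beta>1_def)
      ultimately show ?thesis
        unfolding split[of b] split[of "\<beta>1 - b0"]
        by (simp add: sum.distrib sum_subtractf sum_distrib_left)
    qed
    moreover have "(\<Sum>i\<in>- T0. \<bar>b0 $ i\<bar>) \<le> l1_norm b0" by (simp add: split sum_nonneg)
    ultimately show ?thesis unfolding L_def by linarith
  qed
  obtain N where N: "norm (vrestrict T0 h) \<le> N" "norm h \<le> N + L / sqrt m"
    "(1 - \<delta>) * N \<le> sqrt (2 * m) * (2 * \<Lambda>) + \<theta> * L / sqrt m"
    using cone[OF m(1,2) T0 hc] unfolding L_def by blast
  define s where "s = sqrt m"
  have s: "s > 0" "real m = s * s" using m by (auto simp: s_def)
  have "L \<le> s * N + 2 * (A * (real m * \<Lambda>))"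
  proof -
    have "(\<Sum>i\<in>T0. \<bar>h $ i\<bar>) \<le> s * norm (vrestrict T0 h)"
      unfolding norm_vrestrict s_def by (rule sum_abs_le_L2_set) fact
    also have "\<dots> \<le> s * N" using N s by simp
    finally have "L \<le> s * N + 2 * (A * (real m * \<tau>))" using L b0l by linarith
    moreover have "A * (real m * \<tau>) \<le> A * (real m * \<Lambda>)"
      using A \<Lambda> by (intro mult_left_mono) auto
    ultimately show ?thesis by linarith
  qed
  then have Ls: "L / s \<le> N + 2 * A * s * \<Lambda>" using s by (simp add: divide_le_eq algebra_simps)
  \<comment> \<open>The multiple \<open>\<theta> * N\<close> moves to the left, where it turns the
    factor \<open>1 - \<delta>\<close> into \<open>D\<close>.\<close>
  have "\<theta> * (L / s) \<le> \<theta> * (N + 2 * A * s * \<Lambda>)" using Ls \<theta>_nonneg by (rule mult_left_mono)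
  then have "D * N \<le> (2 * sqrt 2 + 2 * \<theta> * A) * s * \<Lambda>"
    using N(3) by (simp add: D_def s_def real_sqrt_mult algebra_simps)
  then have N_le: "N \<le> (2 * sqrt 2 + 2 * \<theta> * A) / D * (s * \<Lambda>)"
    using D by (simp add: pos_le_divide_eq algebra_simps)
  have "norm (b - \<beta>) \<le> norm h + norm b0 + norm \<beta>2"
  proof -
    have "b - \<beta> = h - b0 - \<beta>2" by (simp add: h_def \<beta>12)
    then show ?thesis using norm_triangle_ineq4[of "h - b0" \<beta>2] norm_triangle_ineq4[of h b0] by simp
  qed
  also have "\<dots> \<le> 2 * N + 2 * A * s * \<Lambda> + A * (s * \<Lambda>) + s * \<Lambda>"
  proof -
    have "s * \<tau> \<le> s * \<Lambda>" "A * (s * \<tau>) \<le> A * (s * \<Lambda>)"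
      using s A \<Lambda> by (auto intro!: mult_left_mono)
    then show ?thesis using N(2) Ls b0n n2 unfolding s_def[symmetric] by linarith
  qed
  also have "\<dots> \<le> (2 * (2 * sqrt 2 + 2 * \<theta> * A) / D + 3 * A + 1) * (s * \<Lambda>)"
  proof -
    define W where "W = (2 * sqrt 2 + 2 * \<theta> * A) / D"
    have "2 * (2 * sqrt 2 + 2 * \<theta> * A) / D = 2 * W" by (simp add: W_def)
    then show ?thesis using N_le unfolding W_def[symmetric] by (simp add: algebra_simps)
  qed
  also have "\<dots> \<le> C2_const \<delta> \<theta> * (s * \<Lambda>)"
    using C2_bound[OF \<delta>_nonneg \<theta>_nonneg less_1] s \<Lambda> \<open>\<tau> > 0\<close>
    unfolding A_def D_def by (intro mult_right_mono) auto
  finally have "(norm (b - \<beta>))\<^sup>2 \<le> (C2_const \<delta> \<theta> * (s * \<Lambda>))\<^sup>2"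
    by (intro power_mono) auto
  also have "\<dots> = (C2_const \<delta> \<theta>)\<^sup>2 * \<Lambda>\<^sup>2 * m"
    using s(2) by (simp add: power_mult_distrib power2_eq_square)
  also have "\<dots> \<le> (C2_const \<delta> \<theta>)\<^sup>2 * \<Lambda>\<^sup>2 * (1 + R / \<tau>\<^sup>2)"
    using m(4) by (intro mult_left_mono) auto
  finally show ?thesis by (simp add: \<Lambda>_def R_def)
qed

end

section \<open>Attainment of the restricted isometry and orthogonality constants\<close>

text \<open>On the reals \<open>LEAST\<close> is meaningful only if a minimum exists; a nonempty
  closed set bounded below contains its infimum.\<close>

lemma closed_bdd_below_Least:
  fixes P :: "real \<Rightarrow> bool"
  assumes "P c" "closed {d. P d}" "\<And>d. P d \<Longrightarrow> l \<le> d"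
  shows "P (LEAST d. P d)"
proof -
  have bdd: "bdd_below {d. P d}" using assms(3) by (intro bdd_belowI[of _ l]) auto
  then have "P (Inf {d. P d})" using closed_contains_Inf[of "{d. P d}"] assms by blast
  moreover have "Inf {d. P d} \<le> d" if "P d" for d using bdd that by (intro cInf_lower) auto
  ultimately show ?thesis using Least_equality[of P "Inf {d. P d}"] by auto
qed

text \<open>A crude bound that makes the number of columns an admissible constant in both
  definitions.\<close>

lemma norm_sub_mult_le:
  fixes X :: "real ^ 'p ^ 'n"
  assumes "\<And>j. norm (column j X) = 1"
  shows "norm (sub_mult X T c) \<le> sqrt (CARD('p)) * L2_set c T"
proof -
  have "norm (sub_mult X T c) \<le> (\<Sum>j\<in>T. norm (c j *\<^sub>R column j X))"
    unfolding sub_mult_def by (rule norm_sum)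
  also have "\<dots> = (\<Sum>j\<in>T. \<bar>c j\<bar>)" by (simp add: assms)
  also have "\<dots> \<le> sqrt (CARD('p)) * L2_set c T"
    by (rule sum_abs_le_L2_set) (simp add: card_mono)
  finally show ?thesis .
qed

lemma matrix_mult_eq_sub_mult:
  fixes X :: "real ^ 'p ^ 'n"
  assumes "\<And>i. i \<notin> T \<Longrightarrow> w $ i = 0"
  shows "X *v w = sub_mult X T (($) w)"
proof -
  have "X *v w = (\<Sum>j\<in>UNIV. w $ j *\<^sub>R column j X)"
    by (simp add: matrix_mult_sum scalar_mult_eq_scaleR)
  also have "\<dots> = sub_mult X T (($) w)"
    unfolding sub_mult_def using assms by (intro sum.mono_neutral_right) auto
  finally show ?thesis .
qed

lemma norm_eq_L2_set:
  fixes w :: "real ^ 'p"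
  assumes "\<And>i. i \<notin> T \<Longrightarrow> w $ i = 0"
  shows "norm w = L2_set (($) w) T"
proof -
  have "vrestrict T w = w" using assms by (auto simp: vec_eq_iff)
  then show ?thesis using norm_vrestrict[of T w] by simp
qed

text \<open>The admissible constants form a closed set, being cut out by non-strict inequalities. A
  single unit column forces them to be nonnegative.\<close>

lemma ric_bounds:
  fixes X :: "real ^ 'p ^ 'n"
  assumes col: "\<And>j. norm (column j X) = 1" and "S \<ge> 1"
  shows "card T \<le> S \<Longrightarrow> (1 - ric X S) * (L2_set c T)\<^sup>2 \<le> (norm (sub_mult X T c))\<^sup>2"
    and "card T \<le> S \<Longrightarrow> (norm (sub_mult X T c))\<^sup>2 \<le> (1 + ric X S) * (L2_set c T)\<^sup>2"
    and "ric X S \<ge> 0"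
proof -
  define P where "P d \<longleftrightarrow> (\<forall>T c. card T \<le> S \<longrightarrow>
     (1 - d) * (L2_set c T)\<^sup>2 \<le> (norm (sub_mult X T c))\<^sup>2 \<and>
     (norm (sub_mult X T c))\<^sup>2 \<le> (1 + d) * (L2_set c T)\<^sup>2)" for d
  have nonneg: "0 \<le> d" if "P d" for d
  proof -
    have "(norm (sub_mult X {undefined} (\<lambda>_. 1)))\<^sup>2 \<le> (1 + d) * (L2_set (\<lambda>_. 1) {undefined :: 'p})\<^sup>2"
      using that \<open>S \<ge> 1\<close> unfolding P_def by (metis card.empty card_insert_disjoint empty_iff
        finite.emptyI One_nat_def)
    then show ?thesis by (simp add: sub_mult_def col)
  qed
  have "P (LEAST d. P d)"
  proof (rule closed_bdd_below_Least[OF _ _ nonneg])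
    show "P (CARD('p))"
      unfolding P_def
    proof (intro allI impI conjI)
      fix T :: "'p set" and c :: "'p \<Rightarrow> real"
      have "(1 - real CARD('p)) * (L2_set c T)\<^sup>2 \<le> 0"
        by (intro mult_nonpos_nonneg) (simp_all add: Suc_leI)
      also have "\<dots> \<le> (norm (sub_mult X T c))\<^sup>2" by simp
      finally show "(1 - real CARD('p)) * (L2_set c T)\<^sup>2 \<le> (norm (sub_mult X T c))\<^sup>2" .
      have "(norm (sub_mult X T c))\<^sup>2 \<le> (sqrt (CARD('p)) * L2_set c T)\<^sup>2"
        using norm_sub_mult_le[OF col] by (intro power_mono) auto
      also have "\<dots> \<le> (1 + real CARD('p)) * (L2_set c T)\<^sup>2"
        by (simp add: power_mult_distrib mult_right_mono)
      finally show "(norm (sub_mult X T c))\<^sup>2 \<le> (1 + real CARD('p)) * (L2_set c T)\<^sup>2" .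
    qed
    show "closed {d. P d}"
      unfolding P_def by (intro closed_Collect_all closed_Collect_imp closed_Collect_conj
          closed_Collect_le continuous_intros) auto
  qed
  moreover have "ric X S = (LEAST d. P d)" by (simp add: ric_def P_def)
  ultimately have P: "P (ric X S)" by simp
  then show "card T \<le> S \<Longrightarrow> (1 - ric X S) * (L2_set c T)\<^sup>2 \<le> (norm (sub_mult X T c))\<^sup>2"
    "card T \<le> S \<Longrightarrow> (norm (sub_mult X T c))\<^sup>2 \<le> (1 + ric X S) * (L2_set c T)\<^sup>2"
    unfolding P_def by blast+
  show "ric X S \<ge> 0" using P by (rule nonneg)
qed

text \<open>As for \<open>ric_bounds\<close>; the lower bound 0 now comes from two distinct
  columns.\<close>

lemma roc_bounds:
  fixes X :: "real ^ 'p ^ 'n"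
  assumes col: "\<And>j. norm (column j X) = 1" and S: "S \<ge> 1" "S' \<ge> 1" and p: "CARD('p) \<ge> 2"
  shows "T \<inter> T' = {} \<Longrightarrow> card T \<le> S \<Longrightarrow> card T' \<le> S' \<Longrightarrow>
      \<bar>sub_mult X T c \<bullet> sub_mult X T' c'\<bar> \<le> roc X S S' * L2_set c T * L2_set c' T'"
    and "roc X S S' \<ge> 0"
proof -
  define P where "P d \<longleftrightarrow> (\<forall>T T' c c'. T \<inter> T' = {} \<longrightarrow> card T \<le> S \<longrightarrow> card T' \<le> S' \<longrightarrow>
     \<bar>sub_mult X T c \<bullet> sub_mult X T' c'\<bar> \<le> d * L2_set c T * L2_set c' T')" for d
  obtain i j :: 'p where ij: "i \<noteq> j"
    using p card_le_Suc0_iff_eq[of "UNIV :: 'p set"] by auto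
  have nonneg: "0 \<le> d" if "P d" for d
  proof -
    have "\<bar>sub_mult X {i} (\<lambda>_. 1) \<bullet> sub_mult X {j} (\<lambda>_. 1)\<bar>
        \<le> d * L2_set (\<lambda>_. 1) {i} * L2_set (\<lambda>_. 1) {j}"
      using that[unfolded P_def, rule_format, of "{i}" "{j}" "\<lambda>_. 1" "\<lambda>_. 1"] S ij by simp
    then show ?thesis by (simp add: order_trans[OF abs_ge_zero])
  qed
  have "P (LEAST d. P d)"
  proof (rule closed_bdd_below_Least[OF _ _ nonneg])
    show "P (CARD('p))"
      unfolding P_def
    proof (intro allI impI)
      fix T T' :: "'p set" and c c' :: "'p \<Rightarrow> real"
      have "\<bar>sub_mult X T c \<bullet> sub_mult X T' c'\<bar> \<le> norm (sub_mult X T c) * norm (sub_mult X T' c')"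
        by (rule Cauchy_Schwarz_ineq2)
      also have "\<dots> \<le> (sqrt (CARD('p)) * L2_set c T) * (sqrt (CARD('p)) * L2_set c' T')"
        by (intro mult_mono norm_sub_mult_le col) auto
      also have "\<dots> = CARD('p) * L2_set c T * L2_set c' T'" by simp
      finally show "\<bar>sub_mult X T c \<bullet> sub_mult X T' c'\<bar> \<le> CARD('p) * L2_set c T * L2_set c' T'" .
    qed
    show "closed {d. P d}"
      unfolding P_def
      by (intro closed_Collect_all closed_Collect_imp closed_Collect_le continuous_intros) auto
  qed
  moreover have "roc X S S' = (LEAST d. P d)" by (simp add: roc_def P_def)
  ultimately have P: "P (roc X S S')" by simp
  then show "T \<inter> T' = {} \<Longrightarrow> card T \<le> S \<Longrightarrow> card T' \<le> S' \<Longrightarrow>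
      \<bar>sub_mult X T c \<bullet> sub_mult X T' c'\<bar> \<le> roc X S S' * L2_set c T * L2_set c' T'"
    unfolding P_def by blast
  show "roc X S S' \<ge> 0" using P by (rule nonneg)
qed

section \<open>Measurability of the error event\<close>

lemma norm_le_l1_norm: "norm b \<le> l1_norm b"
  unfolding l1_norm_def by (rule norm_le_l1_cart)

text \<open>
  By compactness, some minimiser lies in the closed set \<open>A\<close> unless a rational \<open>q\<close> separates the
  optimal value over \<open>A\<close> from the overall one; for fixed \<open>q\<close> the sets of data involved are closed.
\<close>

lemma closed_selector_borel:
  fixes X :: "real ^ 'p ^ 'n"
  assumes A: "closed A"
  shows "{y. \<exists>b\<in>A. is_dantzig_selector X y lam \<sigma> b} \<in> sets borel"
proof -
  define feas where "feas y b \<longleftrightarrow> infnorm (transpose X *v (y - X *v b)) \<le> lam * \<sigma>" for y b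
  \<comment> \<open>Every \<open>b\<close> with l1 norm at most \<open>q\<close> lies in this ball,
    which exhibits the set as a projection along a compact factor, hence closed.\<close>
  define D where "D A q = {y. \<exists>b. b \<in> cball 0 q \<and> (b, y) \<in> {(b, y). b \<in> A \<and> l1_norm b \<le> q \<and> feas y b}}"
    for A and q :: real
  have D_iff: "y \<in> D A q \<longleftrightarrow> (\<exists>b\<in>A. l1_norm b \<le> q \<and> feas y b)" for y A q
    unfolding D_def by (auto intro: order_trans[OF norm_le_l1_norm])
  have cont: "continuous_on T l1_norm" for T :: "(real ^ 'p) set"
    unfolding l1_norm_def by (intro continuous_intros)
  have closed_D: "closed (D A q)" if "closed A" for A q
    unfolding D_def
  proof (rule closed_compact_projection)
    have "{(b, y). b \<in> A \<and> l1_norm b \<le> q \<and> feas y b} =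
        fst -` A \<inter> {p. l1_norm (fst p) \<le> q} \<inter> {p. feas (snd p) (fst p)}" by auto
    also have "closed \<dots>"
      unfolding feas_def l1_norm_def
      by (intro closed_Int closed_vimage that closed_Collect_le continuous_intros
        bounded_linear.continuous_on[OF matrix_vector_mul_bounded_linear])
    finally show "closed {(b, y). b \<in> A \<and> l1_norm b \<le> q \<and> feas y b}" .
  qed simp
  have iff: "(\<exists>b\<in>A. is_dantzig_selector X y lam \<sigma> b) \<longleftrightarrow>
      (\<exists>q\<in>\<rat>. y \<in> D A q) \<and> (\<forall>q\<in>\<rat>. y \<in> D UNIV q \<longrightarrow> y \<in> D A q)" for y
  proof
    assume "\<exists>b\<in>A. is_dantzig_selector X y lam \<sigma> b"
    then obtain b where b: "b \<in> A" "feas y b" "\<And>b'. feas y b' \<Longrightarrow> l1_norm b \<le> l1_norm b'"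
      unfolding is_dantzig_selector_def is_arg_min_def feas_def by (auto simp: not_less)
    obtain q where "q \<in> \<rat>" "l1_norm b < q" using Rats_dense_in_real[of "l1_norm b" "l1_norm b + 1"] by auto
    then show "(\<exists>q\<in>\<rat>. y \<in> D A q) \<and> (\<forall>q\<in>\<rat>. y \<in> D UNIV q \<longrightarrow> y \<in> D A q)"
      using b unfolding D_iff by (meson UNIV_I less_imp_le order_trans)
  next
    assume *: "(\<exists>q\<in>\<rat>. y \<in> D A q) \<and> (\<forall>q\<in>\<rat>. y \<in> D UNIV q \<longrightarrow> y \<in> D A q)"
    then obtain q b0 where q: "q \<in> \<rat>" "b0 \<in> A" "l1_norm b0 \<le> q" "feas y b0" unfolding D_iff by blast
    define K where "K = A \<inter> {b. l1_norm b \<le> q} \<inter> {b. feas y b}"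
    have "closed K"
      unfolding K_def feas_def l1_norm_def
      by (intro closed_Int A closed_Collect_le continuous_intros
        bounded_linear.continuous_on[OF matrix_vector_mul_bounded_linear])
    moreover have "K \<subseteq> cball 0 q"
      by (auto simp: K_def intro: order_trans[OF norm_le_l1_norm])
    ultimately have "compact K"
      using bounded_subset[OF bounded_cball] by (auto simp: compact_eq_bounded_closed)
    moreover have "K \<noteq> {}" using q by (auto simp: K_def)
    ultimately obtain b where b: "b \<in> K" "\<And>b'. b' \<in> K \<Longrightarrow> l1_norm b \<le> l1_norm b'"
      using continuous_attains_inf[OF _ _ cont] by metis
    \<comment> \<open>A better feasible point would, via a rational \<open>r\<close> between the two
      values, put \<open>y\<close> into \<open>D UNIV r\<close> and so into \<open>D A r\<close>,
      against the minimality of \<open>b\<close> in \<open>K\<close>.\<close>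
    have "l1_norm b \<le> l1_norm b'" if "feas y b'" for b'
    proof (rule ccontr)
      assume "\<not> l1_norm b \<le> l1_norm b'"
      then obtain r where r: "r \<in> \<rat>" "l1_norm b' < r" "r < l1_norm b"
        using Rats_dense_in_real by (meson not_le)
      then have "y \<in> D UNIV r" using that by (auto simp: D_iff intro!: exI[of _ b'])
      then obtain b'' where "b'' \<in> A" "l1_norm b'' \<le> r" "feas y b''"
        using * r(1) D_iff by blast
      then show False using b r by (fastforce simp: K_def)
    qed
    then show "\<exists>b\<in>A. is_dantzig_selector X y lam \<sigma> b"
      using b(1) unfolding is_dantzig_selector_def is_arg_min_def feas_def K_def
      by (auto simp: not_less)
  qed
  have [measurable]: "D B q \<in> sets borel" if "closed B" for B q
    using closed_D[OF that] by simp
  have "{y. \<exists>b\<in>A. is_dantzig_selector X y lam \<sigma> b} =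
      (\<Union>q\<in>\<rat>. D A q) \<inter> (\<Inter>q\<in>\<rat>. - D UNIV q \<union> D A q)"
    using iff by auto
  also have "\<dots> \<in> sets borel"
    using A countable_rat by (intro sets.Int sets.countable_UN' sets.countable_INT' sets.Un
      borel_comp closed_D[THEN borel_closed]) (auto simp: Rats_def)
  finally show ?thesis .
qed

text \<open>The bound is claimed for all minimisers at once, so measurability of the event is not
  automatic. Its complement is a countable union over margins \<open>1 / (n + 1)\<close>, each of
  which makes the set of bad \<open>b\<close> closed.\<close>

lemma selector_error_borel:
  fixes X :: "real ^ 'p ^ 'n"
  shows "{y. \<forall>b. is_dantzig_selector X y lam \<sigma> b \<longrightarrow> (norm (b - \<beta>))\<^sup>2 \<le> K} \<in> sets borel"
proof -
  define A where "A n = {b. K + 1 / real (Suc n) \<le> (norm (b - \<beta>))\<^sup>2}" for n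
  have "closed (A n)" for n
    unfolding A_def by (intro closed_Collect_le continuous_intros)
  have ex: "(\<exists>n. b \<in> A n) \<longleftrightarrow> \<not> (norm (b - \<beta>))\<^sup>2 \<le> K" for b
  proof
    assume "\<not> (norm (b - \<beta>))\<^sup>2 \<le> K"
    then obtain n where "inverse (real (Suc n)) < (norm (b - \<beta>))\<^sup>2 - K"
      using reals_Archimedean[of "(norm (b - \<beta>))\<^sup>2 - K"] by auto
    then show "\<exists>n. b \<in> A n" by (intro exI[of _ n]) (simp add: A_def inverse_eq_divide)
  next
    assume "\<exists>n. b \<in> A n"
    then obtain n where "K + 1 / real (Suc n) \<le> (norm (b - \<beta>))\<^sup>2" by (auto simp: A_def)
    moreover have "1 / real (Suc n) > 0" by simp
    ultimately show "\<not> (norm (b - \<beta>))\<^sup>2 \<le> K" by linarith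
  qed
  have "{y. \<forall>b. is_dantzig_selector X y lam \<sigma> b \<longrightarrow> (norm (b - \<beta>))\<^sup>2 \<le> K} =
      - (\<Union>n. {y. \<exists>b\<in>A n. is_dantzig_selector X y lam \<sigma> b})"
    using ex by blast
  also have "\<dots> \<in> sets borel"
    using closed_selector_borel[OF \<open>closed (A _)\<close>] by (intro borel_comp sets.countable_UN) auto
  finally show ?thesis .
qed

section \<open>Gaussian noise\<close>

text \<open>
  Comparison with \<open>1 / x\<close> would only give a non-strict inequality; the next upper convergent
  \<open>g x = (x\<^sup>2 + 2) / (x (x\<^sup>2 + 3))\<close> of the continued fraction for Mills' ratio satisfies \<open>x g x - g' x > 1\<close> and \<open>g x < 1 / x\<close>.
\<close>

lemma nn_integral_std_normal_tail_less:
  assumes u: "u > 0"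
  shows "(\<integral>\<^sup>+x. ennreal (std_normal_density x) * indicator {u..} x \<partial>lborel)
    < ennreal (std_normal_density u / u)"
proof -
  define g where "g x = (x\<^sup>2 + 2) / (x * (x\<^sup>2 + 3))" for x :: real
  define g' where "g' x = (2 * x * (x * (x\<^sup>2 + 3)) - (x\<^sup>2 + 2) * (3 * x\<^sup>2 + 3)) / (x * (x\<^sup>2 + 3))\<^sup>2" for x :: real
  \<comment> \<open>The derivative of \<open>- (std_normal_density x * g x)\<close>, because the
    density has derivative \<open>- x\<close> times itself.\<close>
  define f where "f x = std_normal_density x * (x * g x - g' x)" for x
  have pos: "x * (x\<^sup>2 + 3) > 0" if "x > 0" for x :: real
    using that by (simp add: add_nonneg_pos)
  have gap: "x * g x - g' x = 1 + 6 / (x * (x\<^sup>2 + 3))\<^sup>2" if "x > 0" for x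
  proof -
    define q where "q = x * (x\<^sup>2 + 3)"
    have q: "q \<noteq> 0" using pos[OF that] unfolding q_def by (rule less_imp_neq[THEN not_sym])
    have "x * g x - g' x = (x * (x\<^sup>2 + 2) * q - (2 * x * q - (x\<^sup>2 + 2) * (3 * x\<^sup>2 + 3))) / q\<^sup>2"
      unfolding g_def g'_def q_def[symmetric] using q by (simp add: diff_divide_distrib power2_eq_square)
    also have "x * (x\<^sup>2 + 2) * q - (2 * x * q - (x\<^sup>2 + 2) * (3 * x\<^sup>2 + 3)) = q\<^sup>2 + 6"
      unfolding q_def by algebra
    also have "\<dots> / q\<^sup>2 = 1 + 6 / q\<^sup>2" using q by (simp add: add_divide_distrib)
    finally show ?thesis by (simp add: q_def)
  qed
  have deriv: "((\<lambda>x. - (std_normal_density x * g x)) has_real_derivative f x) (at x)" if "x > 0" for x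
  proof -
    have 1: "(std_normal_density has_real_derivative - x * std_normal_density x) (at x)"
    proof -
      have "((\<lambda>x. c * exp (- x\<^sup>2 / 2)) has_real_derivative - x * (c * exp (- x\<^sup>2 / 2))) (at x)" for c
        by (auto intro!: derivative_eq_intros)
      then show ?thesis unfolding std_normal_density_def[abs_def] .
    qed
    have "(g has_real_derivative g' x) (at x)"
      unfolding g_def[abs_def] g'_def using pos[OF that] that
      by (auto intro!: derivative_eq_intros simp: power2_eq_square algebra_simps)
    from DERIV_minus[OF DERIV_mult[OF 1 this]] show ?thesis
      by (simp add: f_def algebra_simps)
  qed
  have f_ge: "std_normal_density x \<le> f x" if "x > 0" for x
    using mult_left_mono[of 1 "1 + 6 / (x * (x\<^sup>2 + 3))\<^sup>2" "std_normal_density x"]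
    by (simp add: f_def gap[OF that])
  have lim: "((\<lambda>x. - (std_normal_density x * g x)) \<longlongrightarrow> 0) at_top"
    unfolding std_normal_density_def g_def by real_asymp
  have "(\<integral>\<^sup>+x. ennreal (std_normal_density x) * indicator {u..} x \<partial>lborel)
      \<le> (\<integral>\<^sup>+x. ennreal (f x) * indicator {u..} x \<partial>lborel)"
    using f_ge u by (intro nn_integral_mono) (auto split: split_indicator intro!: ennreal_leI)
  also have "\<dots> = 0 - (- (std_normal_density u * g u))"
  proof (rule nn_integral_FTC_atLeast)
    show "f \<in> borel_measurable borel" unfolding f_def g_def g'_def by measurable
    show "0 \<le> f x" if "u \<le> x" for x
      using f_ge[of x] normal_density_nonneg[of 0 1 x] u that by linarith
  qed (use deriv u lim in auto)
  also have "\<dots> < ennreal (std_normal_density u / u)"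
  proof -
    have "(u\<^sup>2 + 2) / (u\<^sup>2 + 3) < 1" by (simp add: divide_less_eq add_nonneg_pos)
    from divide_strict_right_mono[OF this u] have "g u < 1 / u" by (simp add: g_def mult.commute)
    then have "std_normal_density u * g u < std_normal_density u * (1 / u)"
      by (intro mult_strict_left_mono normal_density_pos) auto
    then show ?thesis using u by (intro ennreal_lessI divide_pos_pos normal_density_pos) auto
  qed
  finally show ?thesis .
qed

context prob_space begin

lemma normal_tail_less:
  assumes X: "distributed M lborel X (normal_density 0 \<sigma>)" and "\<sigma> > 0" "u > 0"
  shows "prob {\<omega> \<in> space M. \<bar>X \<omega>\<bar> > u * \<sigma>} < 2 * (std_normal_density u / u)"
proof -
  have tail: "prob {\<omega> \<in> space M. Y \<omega> \<ge> u} < std_normal_density u / u"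
    if Y: "distributed M lborel Y std_normal_density" for Y
  proof -
    have "emeasure M (Y -` {u..} \<inter> space M) = (\<integral>\<^sup>+x. ennreal (std_normal_density x) * indicator {u..} x \<partial>lborel)"
      using Y by (intro distributed_emeasure) auto
    also have "\<dots> < ennreal (std_normal_density u / u)"
      by (rule nn_integral_std_normal_tail_less) fact
    finally have "prob (Y -` {u..} \<inter> space M) < std_normal_density u / u"
      by (simp add: emeasure_eq_measure ennreal_less_iff)
    moreover have "Y -` {u..} \<inter> space M = {\<omega> \<in> space M. Y \<omega> \<ge> u}" by auto
    ultimately show ?thesis by simp
  qed
  \<comment> \<open>Both signs of \<open>c\<close> are used: the left tail of \<open>X\<close> is
    the right tail of its negative.\<close>
  have Y: "distributed M lborel (\<lambda>\<omega>. c * X \<omega>) std_normal_density" if "\<bar>c\<bar> = 1 / \<sigma>" for c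
    using normal_density_affine[OF X \<open>\<sigma> > 0\<close>, of c 0] that \<open>\<sigma> > 0\<close> by (cases "c = 0") auto
  have [measurable]: "X \<in> borel_measurable M" using distributed_measurable[OF X] by simp
  have "prob {\<omega> \<in> space M. \<bar>X \<omega>\<bar> > u * \<sigma>}
      \<le> prob ({\<omega> \<in> space M. 1 / \<sigma> * X \<omega> \<ge> u} \<union> {\<omega> \<in> space M. - (1 / \<sigma>) * X \<omega> \<ge> u})"
    using \<open>\<sigma> > 0\<close> by (intro finite_measure_mono) (auto simp: field_simps abs_real_def split: if_splits)
  also have "\<dots> \<le> prob {\<omega> \<in> space M. 1 / \<sigma> * X \<omega> \<ge> u} + prob {\<omega> \<in> space M. - (1 / \<sigma>) * X \<omega> \<ge> u}"
    by (rule measure_Un_le) auto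
  also have "\<dots> < 2 * (std_normal_density u / u)"
    using tail[OF Y[of "1 / \<sigma>"]] tail[OF Y[of "- (1 / \<sigma>)"]] \<open>\<sigma> > 0\<close> by simp
  finally show ?thesis .
qed

lemma isotropic_normal_inner:
  fixes z :: "'a \<Rightarrow> real ^ 'n"
  assumes z: "isotropic_normal z \<sigma>" and "\<sigma> > 0" and c: "norm c = 1"
  shows "distributed M lborel (\<lambda>\<omega>. c \<bullet> z \<omega>) (normal_density 0 \<sigma>)"
proof -
  \<comment> \<open>Only nonzero coefficients: a summand with coefficient 0 would have no normal
    density.\<close>
  define I where "I = {i. c $ i \<noteq> 0}"
  have "I \<noteq> {}"
  proof
    assume "I = {}"
    then have "c = 0" by (auto simp: I_def vec_eq_iff)
    then show False using c by simp
  qed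
  have eq: "(\<Sum>i\<in>I. c $ i * z \<omega> $ i) = c \<bullet> z \<omega>" for \<omega>
    unfolding inner_vec_def I_def by (intro sum.mono_neutral_cong_left) auto
  have "(\<Sum>i\<in>I. (c $ i)\<^sup>2) = (norm c)\<^sup>2"
    unfolding norm_vec_def L2_set_def I_def
    by (subst real_sqrt_pow2) (auto simp: sum_nonneg intro!: sum.mono_neutral_left)
  then have var: "(\<Sum>i\<in>I. (\<bar>c $ i\<bar> * \<sigma>)\<^sup>2) = \<sigma>\<^sup>2"
    by (simp add: power_mult_distrib sum_distrib_right[symmetric] c)
  have "indep_vars (\<lambda>_. borel) (\<lambda>i \<omega>. z \<omega> $ i) I"
    using z unfolding isotropic_normal_def by (blast intro: indep_vars_subset)
  then have ind: "indep_vars (\<lambda>_. borel) (\<lambda>i \<omega>. c $ i * z \<omega> $ i) I"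
    by (rule indep_vars_compose2) auto
  have "distributed M lborel (\<lambda>\<omega>. \<Sum>i\<in>I. c $ i * z \<omega> $ i)
      (normal_density (\<Sum>i\<in>I. 0) (sqrt (\<Sum>i\<in>I. (\<bar>c $ i\<bar> * \<sigma>)\<^sup>2)))"
  proof (rule sum_indep_normal[OF _ \<open>I \<noteq> {}\<close> ind])
    fix i assume i: "i \<in> I"
    have "distributed M lborel (\<lambda>\<omega>. z \<omega> $ i) (normal_density 0 \<sigma>)"
      using z by (simp add: isotropic_normal_def)
    from normal_density_affine[OF this \<open>\<sigma> > 0\<close>, of "c $ i" 0] i
    show "distributed M lborel (\<lambda>\<omega>. c $ i * z \<omega> $ i) (normal_density 0 (\<bar>c $ i\<bar> * \<sigma>))"
      by (simp add: I_def)
  qed (use \<open>\<sigma> > 0\<close> in \<open>auto simp: I_def\<close>)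
  then show ?thesis unfolding eq var using \<open>\<sigma> > 0\<close> by simp
qed

lemma isotropic_normal_measurable:
  fixes z :: "'a \<Rightarrow> real ^ 'n"
  assumes "isotropic_normal z \<sigma>"
  shows "z \<in> borel_measurable M"
proof (subst borel_measurable_euclidean_space, intro ballI)
  fix b :: "real ^ 'n" assume "b \<in> Basis"
  then obtain i where b: "b = axis i 1" by (auto simp: Basis_vec_def)
  have "(\<lambda>\<omega>. z \<omega> $ i) \<in> borel_measurable M"
    using assms distributed_measurable unfolding isotropic_normal_def by fastforce
  then show "(\<lambda>\<omega>. z \<omega> \<bullet> b) \<in> borel_measurable M" by (simp add: b inner_axis)
qed

text \<open>Union bound at \<open>u = sqrt (1 + a) * sqrt (2 * ln p)\<close>, where the density is
  \<open>p powr (- (1 + a)) / sqrt (2 * pi)\<close>. The factor \<open>p\<close> from the columns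
  leaves \<open>p powr (- a)\<close>, and division by \<open>u\<close> produces the logarithm. The
  strict tail bound makes the result strict.\<close>

lemma isotropic_normal_correlations:
  fixes X :: "real ^ 'p ^ 'n"
  assumes z: "isotropic_normal z \<sigma>" and "\<sigma> > 0" and p: "CARD('p) \<ge> 2" and "a \<ge> 0"
    and col: "\<And>j. norm (column j X) = 1"
  shows "prob {\<omega> \<in> space M. \<forall>j. \<bar>column j X \<bullet> z \<omega>\<bar> \<le> sqrt (1 + a) * sqrt (2 * ln (real CARD('p))) * \<sigma>}
    > 1 - 1 / (sqrt (pi * ln (real CARD('p))) * real CARD('p) powr a)"
proof -
  define p where "p = real CARD('p)"
  define u where "u = sqrt (1 + a) * sqrt (2 * ln p)"
  have p2: "p \<ge> 2" using p by (simp add: p_def)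
  have lnp: "ln p > 0" using p2 by simp
  have u: "u > 0" using lnp \<open>a \<ge> 0\<close> by (simp add: u_def)
  have u2: "u\<^sup>2 = 2 * (1 + a) * ln p" using lnp \<open>a \<ge> 0\<close> by (simp add: u_def power_mult_distrib)
  define B where "B j = {\<omega> \<in> space M. \<bar>column j X \<bullet> z \<omega>\<bar> > u * \<sigma>}" for j
  have [measurable]: "z \<in> borel_measurable M" using z by (rule isotropic_normal_measurable)
  have B: "B j \<in> events" for j unfolding B_def by measurable
  have "prob (\<Union>j. B j) \<le> (\<Sum>j\<in>UNIV. prob (B j))"
    using B by (intro finite_measure_subadditive_finite) auto
  also have "\<dots> < (\<Sum>j\<in>(UNIV :: 'p set). 2 * (std_normal_density u / u))"
    unfolding B_def using u \<open>\<sigma> > 0\<close>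
    by (intro sum_strict_mono normal_tail_less isotropic_normal_inner[OF z _ col]) auto
  also have "\<dots> = 2 * p * std_normal_density u / u" by (simp add: p_def)
  also have "std_normal_density u = p powr (- (1 + a)) / sqrt (2 * pi)"
    using p2 by (simp add: std_normal_density_def u2 powr_def field_simps)
  also have "2 * p * (p powr (- (1 + a)) / sqrt (2 * pi)) / u
      = 1 / (sqrt (pi * ln p) * p powr a) / sqrt (1 + a)"
  proof -
    have "p * p powr (- (1 + a)) = 1 / p powr a"
      using p2 powr_add[of p 1 "- (1 + a)"] by (simp add: powr_minus_divide)
    then have "2 * p * (p powr (- (1 + a)) / sqrt (2 * pi)) / u = 2 / p powr a / sqrt (2 * pi) / u"
      by (simp add: mult.assoc)
    then show ?thesis by (simp add: u_def real_sqrt_mult field_simps)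
  qed
  also have "\<dots> \<le> 1 / (sqrt (pi * ln p) * p powr a) / 1"
    using lnp \<open>a \<ge> 0\<close> by (intro divide_left_mono) auto
  finally have "prob (\<Union>j. B j) < 1 / (sqrt (pi * ln p) * p powr a)" by simp
  moreover have "prob (space M - (\<Union>j. B j)) = 1 - prob (\<Union>j. B j)"
    using B by (intro prob_compl) auto
  moreover have "space M - (\<Union>j. B j) = {\<omega> \<in> space M. \<forall>j. \<bar>column j X \<bullet> z \<omega>\<bar> \<le> u * \<sigma>}"
    unfolding B_def by (auto simp: not_less[symmetric])
  ultimately show ?thesis by (simp add: p_def u_def)
qed

end

section \<open>The oracle inequality\<close>

theorem theorem1p2:
  fixes M :: "'w measure"
    and X :: "real ^ 'p ^ 'n"
    and \<beta> :: "real ^ 'p"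
    and z :: "'w \<Rightarrow> real ^ 'n"
    and S :: nat
    and \<sigma> t a lam \<delta> \<theta> :: real
  assumes "prob_space M"
    and "CARD('p) \<ge> 2"
    and "S \<ge> 1"
    and "3 * S \<le> CARD('p)"
    and "\<sigma> > 0"
    and "t > 0"
    and "a \<ge> 0"
    and "\<And>j. norm (column j X) = 1"
    and "\<delta> = ric X (2 * S)"
    and "\<theta> = roc X S (2 * S)"
    and "\<delta> + \<theta> < 1 - t"
    and "sparse_vec S \<beta>"
    and "prob_space.isotropic_normal M z \<sigma>"
    and "lam = (sqrt (1 + a) + 1 / t) * sqrt (2 * ln (real CARD('p)))"
  shows "measure M {\<omega> \<in> space M.
            \<forall>\<beta>'. is_dantzig_selector X (X *v \<beta> + z \<omega>) lam \<sigma> \<beta>' \<longrightarrow>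
              (norm (\<beta>' - \<beta>))\<^sup>2
                \<le> (C2_const \<delta> \<theta>)\<^sup>2 * lam\<^sup>2 * (\<sigma>\<^sup>2 + (\<Sum>i\<in>UNIV. min ((\<beta> $ i)\<^sup>2) (\<sigma>\<^sup>2)))}
         > 1 - 1 / (sqrt (pi * ln (real CARD('p))) * real CARD('p) powr a)"
proof -
  interpret prob_space M by fact
  note S = \<open>S \<ge> 1\<close> and col = assms(8)
  note ric = ric_bounds[OF col, of "2 * S", folded assms(9)]
  note roc = roc_bounds[OF col, of S "2 * S", folded assms(10)]
  interpret restricted_isometry X S \<delta> \<theta>
  proof
    fix T and w :: "real ^ 'p" assume T: "card T \<le> 2 * S" "\<And>i. i \<notin> T \<Longrightarrow> w $ i = 0"
    have "X *v w = sub_mult X T (($) w)" "norm w = L2_set (($) w) T"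
      using T(2) by (auto intro: matrix_mult_eq_sub_mult norm_eq_L2_set)
    then show "(1 - \<delta>) * (norm w)\<^sup>2 \<le> (norm (X *v w))\<^sup>2"
      "(norm (X *v w))\<^sup>2 \<le> (1 + \<delta>) * (norm w)\<^sup>2"
      using ric(1,2)[of T "($) w"] S T(1) by auto
  next
    fix T T' and w w' :: "real ^ 'p"
    assume T: "T \<inter> T' = {}" "card T \<le> S" "card T' \<le> 2 * S"
      "\<And>i. i \<notin> T \<Longrightarrow> w $ i = 0" "\<And>i. i \<notin> T' \<Longrightarrow> w' $ i = 0"
    have "X *v w = sub_mult X T (($) w)" "norm w = L2_set (($) w) T"
      "X *v w' = sub_mult X T' (($) w')" "norm w' = L2_set (($) w') T'"
      using T(4,5) by (auto intro: matrix_mult_eq_sub_mult norm_eq_L2_set)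
    then show "\<bar>(X *v w) \<bullet> (X *v w')\<bar> \<le> \<theta> * norm w * norm w'"
      using roc(1)[of T T' "($) w" "($) w'"] S assms(2) T(1-3) by auto
  qed (use S assms(2,6,11) ric(3) roc(2) in auto)
  define \<kappa> where "\<kappa> = sqrt (2 * ln (real CARD('p)))"
  \<comment> \<open>From \<open>p \<ge> 2\<close> and \<open>2 * ln 2 \<ge> 1\<close>; it ensures
    \<open>\<tau> \<ge> \<sigma>\<close>.\<close>
  have \<kappa>: "\<kappa> \<ge> 1"
  proof -
    have "ln 2 \<le> ln (real CARD('p))" using assms(2) by simp
    then have "1 \<le> 2 * ln (real CARD('p))" using ln2_ge_two_thirds by linarith
    then show ?thesis by (simp add: \<kappa>_def)
  qed
  define \<tau> where "\<tau> = \<kappa> * \<sigma>"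
  have \<tau>: "\<tau> > 0" using \<kappa> \<open>\<sigma> > 0\<close> by (simp add: \<tau>_def)
  define good where "good y \<longleftrightarrow> (\<forall>\<beta>'. is_dantzig_selector X y lam \<sigma> \<beta>' \<longrightarrow>
    (norm (\<beta>' - \<beta>))\<^sup>2 \<le> (C2_const \<delta> \<theta>)\<^sup>2 * lam\<^sup>2 * (\<sigma>\<^sup>2 + (\<Sum>i\<in>UNIV. min ((\<beta> $ i)\<^sup>2) (\<sigma>\<^sup>2))))" for y
  have good: "good (X *v \<beta> + v)" if v: "\<And>j. \<bar>column j X \<bullet> v\<bar> \<le> sqrt (1 + a) * \<kappa> * \<sigma>" for v
    unfolding good_def
  proof (intro allI impI)
    fix b assume sel: "is_dantzig_selector X (X *v \<beta> + v) lam \<sigma> b"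
    \<comment> \<open>\<open>lam * \<sigma>\<close> is
      \<open>sqrt (1 + a) * \<tau> + \<tau> / t\<close>: the first summand absorbs the noise, the
      second the required slack.\<close>
    have "\<tau> / (1 - \<delta> - \<theta>) \<le> \<tau> / t"
      using \<tau> assms(6,11) by (intro divide_left_mono) auto
    then have "\<bar>column j X \<bullet> v\<bar> + \<tau> / (1 - \<delta> - \<theta>) \<le> lam * \<sigma>" for j
      using v[of j] unfolding assms(14) \<kappa>_def[symmetric] \<tau>_def by (simp add: algebra_simps)
    then have "(norm (b - \<beta>))\<^sup>2
        \<le> (C2_const \<delta> \<theta>)\<^sup>2 * (lam * \<sigma>)\<^sup>2 * (1 + (\<Sum>i\<in>UNIV. min ((\<beta> $ i)\<^sup>2) (\<tau>\<^sup>2)) / \<tau>\<^sup>2)"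
      using S assms(12) \<tau> sel unfolding sparse_vec_def by (intro dantzig_selector_error) auto
    \<comment> \<open>Each term is \<open>min ((\<beta> $ i)\<^sup>2 / \<tau>\<^sup>2) 1\<close>,
      which decreases in \<open>\<tau>\<close>.\<close>
    also have "(\<Sum>i\<in>UNIV. min ((\<beta> $ i)\<^sup>2) (\<tau>\<^sup>2)) / \<tau>\<^sup>2 \<le> (\<Sum>i\<in>UNIV. min ((\<beta> $ i)\<^sup>2) (\<sigma>\<^sup>2)) / \<sigma>\<^sup>2"
      unfolding sum_divide_distrib
    proof (rule sum_mono)
      fix i
      have "x / \<tau>\<^sup>2 \<le> x / \<sigma>\<^sup>2" if "x \<ge> 0" for x
        using that \<tau> \<kappa> \<open>\<sigma> > 0\<close> by (intro divide_left_mono) (auto simp: \<tau>_def intro!: power_mono)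
      then have "min ((\<beta> $ i)\<^sup>2 / \<tau>\<^sup>2) 1 \<le> min ((\<beta> $ i)\<^sup>2 / \<sigma>\<^sup>2) 1" by (simp add: min.coboundedI1)
      then show "min ((\<beta> $ i)\<^sup>2) (\<tau>\<^sup>2) / \<tau>\<^sup>2 \<le> min ((\<beta> $ i)\<^sup>2) (\<sigma>\<^sup>2) / \<sigma>\<^sup>2"
        using \<tau> \<open>\<sigma> > 0\<close> by (simp add: min_divide_distrib_right)
    qed
    also have "(C2_const \<delta> \<theta>)\<^sup>2 * (lam * \<sigma>)\<^sup>2 * (1 + (\<Sum>i\<in>UNIV. min ((\<beta> $ i)\<^sup>2) (\<sigma>\<^sup>2)) / \<sigma>\<^sup>2)
        = (C2_const \<delta> \<theta>)\<^sup>2 * lam\<^sup>2 * (\<sigma>\<^sup>2 + (\<Sum>i\<in>UNIV. min ((\<beta> $ i)\<^sup>2) (\<sigma>\<^sup>2)))"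
      using \<open>\<sigma> > 0\<close> by (simp add: power_mult_distrib field_simps)
    finally show "(norm (b - \<beta>))\<^sup>2 \<le> \<dots>" by (simp add: mult_left_mono)
  qed
  have [measurable]: "z \<in> borel_measurable M"
    using assms(13) by (rule isotropic_normal_measurable)
  \<comment> \<open>Monotonicity of the measure below requires the larger event to be
    measurable.\<close>
  have "{y. good y} \<in> sets borel" unfolding good_def by (rule selector_error_borel)
  then have [measurable]: "Measurable.pred borel good" by (simp add: pred_def)
  have "1 - 1 / (sqrt (pi * ln (real CARD('p))) * real CARD('p) powr a)
      < prob {\<omega> \<in> space M. \<forall>j. \<bar>column j X \<bullet> z \<omega>\<bar> \<le> sqrt (1 + a) * \<kappa> * \<sigma>}"
    unfolding \<kappa>_def using assms by (intro isotropic_normal_correlations) auto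
  also have "\<dots> \<le> prob {\<omega> \<in> space M. good (X *v \<beta> + z \<omega>)}"
    using good by (intro finite_measure_mono) auto
  finally show ?thesis unfolding good_def .
qed

end
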